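(* Let $D$ be a skew field, $\sigma$ a ring automorphism of $D$, $\delta$ a $\sigma$-derivation of $D$, and $R=D[X;\sigma,\delta]$. Assume that $R$ is a finitely generated free module of rank $r$ over its center $C$. Let $f\in R$ with bound $f^*\in C$. Then $\deg f^*\le \sqrt{r}\,\deg f$.
   Context: A $\sigma$-derivation is an additive map $\delta:D\to D$ with $\delta(ab)=\sigma(a)\delta(b)+\delta(a)b$. $R=D[X;\sigma,\delta]$ is the Ore polynomial ring: a left $D$-vector space with basis $\{X^n: n\ge 0\}$, with $Xa=\sigma(a)X+\delta(a)$ for $a\in D$; $\deg$ is the degree in $X$, with $\deg 0=-\infty$. A polynomial $\alpha$ is twosided if $R\alpha=\alpha R$. A bound of $f\in R$ is a twosided polynomial $f^*$ such that $Rf^*=f^*R$ is the largest twosided ideal contained in $Rf$; equivalently $Rf^*=\operatorname{Ann}_R(R/Rf)$. It is determined up to left multiplication by nonzero elements of $D$; the hypothesis $f^*\in C$ means that some bound of $f$ lies in $C$. (If $R$ is finitely generated as a module over its center, every nonzero $f$ has nonzero bound.) *)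

theory Defs
  imports
    Complex_Main
    "HOL-Library.Extended_Real"
    "HOL-Computational_Algebra.Polynomial"
    "HOL-Algebra.Ideal"
begin

definition ring_automorphism :: "('a::ring_1 \<Rightarrow> 'a) \<Rightarrow> bool" where
  "ring_automorphism \<sigma> \<longleftrightarrow> bij \<sigma> \<and> \<sigma> 1 = 1 \<and>
     (\<forall>a b. \<sigma> (a + b) = \<sigma> a + \<sigma> b) \<and> (\<forall>a b. \<sigma> (a * b) = \<sigma> a * \<sigma> b)"

definition skew_derivation :: "('a::ring_1 \<Rightarrow> 'a) \<Rightarrow> ('a \<Rightarrow> 'a) \<Rightarrow> bool" where
  "skew_derivation \<sigma> \<delta> \<longleftrightarrow>
     (\<forall>a b. \<delta> (a + b) = \<delta> a + \<delta> b) \<and> (\<forall>a b. \<delta> (a * b) = \<sigma> a * \<delta> b + \<delta> a * b)"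

text \<open>
  The elements of \<open>D[X;\<sigma>,\<delta>]\<close> are represented by the type \<^typ>\<open>'a poly\<close>, whose coefficients are
  read as standing to the left of the powers of \<open>X\<close>. Only the additive group, \<^const>\<open>coeff\<close> and
  \<^const>\<open>degree\<close> of that type are used; its commutative multiplication and \<^const>\<open>Polynomial.smult\<close>
  are not even available over a skew field. Multiplication is determined by
  \<open>X (\<Sum> b\<^sub>i X\<^sup>i) = \<Sum> (\<sigma> b\<^sub>i X\<^sup>i\<^sup>+\<^sup>1 + \<delta> b\<^sub>i X\<^sup>i)\<close>, together with left \<open>D\<close>-linearity in the left factor.
\<close>

definition lscale :: "'a::ring_1 \<Rightarrow> 'a poly \<Rightarrow> 'a poly" where
  "lscale a p = map_poly (\<lambda>b. a * b) p"

definition ore_X_mult :: "('a::ring_1 \<Rightarrow> 'a) \<Rightarrow> ('a \<Rightarrow> 'a) \<Rightarrow> 'a poly \<Rightarrow> 'a poly" where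
  "ore_X_mult \<sigma> \<delta> g = pCons 0 (map_poly \<sigma> g) + map_poly \<delta> g"

definition ore_mult :: "('a::ring_1 \<Rightarrow> 'a) \<Rightarrow> ('a \<Rightarrow> 'a) \<Rightarrow> 'a poly \<Rightarrow> 'a poly \<Rightarrow> 'a poly" where
  "ore_mult \<sigma> \<delta> f g = (\<Sum>i\<le>degree f. lscale (coeff f i) ((ore_X_mult \<sigma> \<delta> ^^ i) g))"

definition ore_ring :: "('a::ring_1 \<Rightarrow> 'a) \<Rightarrow> ('a \<Rightarrow> 'a) \<Rightarrow> 'a poly ring" where
  "ore_ring \<sigma> \<delta> =
     \<lparr>carrier = UNIV, mult = ore_mult \<sigma> \<delta>, one = monom 1 0, zero = 0, add = (+)\<rparr>"

text \<open>Unlike \<^const>\<open>degree\<close>, the zero polynomial gets degree \<open>-\<infinity>\<close>.\<close>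

definition ore_deg :: "'a::zero poly \<Rightarrow> ereal" where
  "ore_deg f = (if f = 0 then -\<infinity> else ereal (real (degree f)))"

definition ring_center :: "('b, 'm) ring_scheme \<Rightarrow> 'b set" where
  "ring_center R = {c \<in> carrier R. \<forall>x\<in>carrier R. c \<otimes>\<^bsub>R\<^esub> x = x \<otimes>\<^bsub>R\<^esub> c}"

text \<open>
  Existence of a basis of \<open>r\<close> elements: every element is a linear combination with unique
  coefficients. The coefficient families are extensional functions, so uniqueness only concerns
  the indices below \<open>r\<close>.
\<close>

definition free_of_rank_over :: "('b, 'm) ring_scheme \<Rightarrow> 'b set \<Rightarrow> nat \<Rightarrow> bool" where
  "free_of_rank_over R C r \<longleftrightarrow>
     (\<exists>e \<in> {..<r} \<rightarrow> carrier R. \<forall>x\<in>carrier R.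
        \<exists>!c. c \<in> {..<r} \<rightarrow>\<^sub>E C \<and> x = (\<Oplus>\<^bsub>R\<^esub>i\<in>{..<r}. c i \<otimes>\<^bsub>R\<^esub> e i))"

text \<open>
  In a ring \<open>R\<close>, \<open>carrier R #>\<^bsub>R\<^esub> a\<close> and \<open>a <#\<^bsub>R\<^esub> carrier R\<close> are the multiplicative cosets,
  that is, the left ideal \<open>Ra\<close> and the right ideal \<open>aR\<close>.
\<close>

definition twosided :: "('b, 'm) ring_scheme \<Rightarrow> 'b \<Rightarrow> bool" where
  "twosided R a \<longleftrightarrow> a \<in> carrier R \<and> carrier R #>\<^bsub>R\<^esub> a = a <#\<^bsub>R\<^esub> carrier R"

definition is_bound :: "('b, 'm) ring_scheme \<Rightarrow> 'b \<Rightarrow> 'b \<Rightarrow> bool" where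
  "is_bound R f b \<longleftrightarrow> twosided R b \<and>
     ideal (carrier R #>\<^bsub>R\<^esub> b) R \<and> carrier R #>\<^bsub>R\<^esub> b \<subseteq> carrier R #>\<^bsub>R\<^esub> f \<and>
     (\<forall>I. ideal I R \<and> I \<subseteq> carrier R #>\<^bsub>R\<^esub> f \<longrightarrow> I \<subseteq> carrier R #>\<^bsub>R\<^esub> b)"

text \<open>
  The construction does give an Ore polynomial ring: it is a ring, the \<open>X\<^sup>n\<close> form a left \<open>D\<close>-basis
  and \<open>X a = \<sigma> a X + \<delta> a\<close>.
\<close>

lemma coeff_lscale [simp]: "coeff (lscale a p) n = a * coeff p n"
  by (simp add: lscale_def coeff_map_poly)

lemma lscale_simps:
  "lscale a (p + q) = lscale a p + lscale a q" "lscale (a + b) p = lscale a p + lscale b p"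
  "lscale a (lscale b p) = lscale (a * b) p" "lscale 0 p = 0" "lscale a 0 = 0" "lscale 1 p = p"
  by (auto intro!: poly_eqI simp: algebra_simps)

lemma lscale_sum: "lscale a (\<Sum>i\<in>A. p i) = (\<Sum>i\<in>A. lscale a (p i))"
  by (induction A rule: infinite_finite_induct) (simp_all add: lscale_simps)

lemma ore_mult_eq:
  assumes "degree f \<le> n"
  shows "ore_mult \<sigma> \<delta> f g = (\<Sum>i\<le>n. lscale (coeff f i) ((ore_X_mult \<sigma> \<delta> ^^ i) g))"
  unfolding ore_mult_def using assms
  by (intro sum.mono_neutral_left) (auto simp: coeff_eq_0 lscale_simps)

lemma ore_mult_add_left: "ore_mult \<sigma> \<delta> (f + g) h = ore_mult \<sigma> \<delta> f h + ore_mult \<sigma> \<delta> g h"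
proof -
  let ?n = "max (degree f) (degree g)"
  have "degree (f + g) \<le> ?n" by (rule degree_add_le_max)
  thus ?thesis
    by (simp add: ore_mult_eq[where n = ?n] lscale_simps sum.distrib)
qed

lemma ore_mult_zero_left [simp]: "ore_mult \<sigma> \<delta> 0 h = 0"
  by (simp add: ore_mult_def lscale_simps)

lemma ore_mult_sum_left: "ore_mult \<sigma> \<delta> (\<Sum>i\<in>A. p i) h = (\<Sum>i\<in>A. ore_mult \<sigma> \<delta> (p i) h)"
  by (induction A rule: infinite_finite_induct) (simp_all add: ore_mult_add_left)

lemma ore_mult_lscale_left: "ore_mult \<sigma> \<delta> (lscale a f) h = lscale a (ore_mult \<sigma> \<delta> f h)"
proof -
  have "degree (lscale a f) \<le> degree f"
    by (rule degree_le) (simp add: coeff_eq_0)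
  thus ?thesis
    by (simp add: ore_mult_eq[where n = "degree f"] lscale_simps lscale_sum)
qed

lemma ore_mult_monom: "ore_mult \<sigma> \<delta> (monom a n) h = lscale a ((ore_X_mult \<sigma> \<delta> ^^ n) h)"
proof -
  have "ore_mult \<sigma> \<delta> (monom a n) h = (\<Sum>i\<le>n. if i = n then lscale a ((ore_X_mult \<sigma> \<delta> ^^ n) h) else 0)"
    unfolding ore_mult_eq[OF degree_monom_le]
    by (rule sum.cong) (auto simp: lscale_simps)
  thus ?thesis by simp
qed

context
  fixes \<sigma> \<delta> :: "'a::ring_1 \<Rightarrow> 'a"
  assumes aut: "ring_automorphism \<sigma>" and der: "skew_derivation \<sigma> \<delta>"
begin

lemma ore_map_zero: "\<sigma> 0 = 0" "\<delta> 0 = 0" "\<delta> 1 = 0"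
proof -
  show "\<sigma> 0 = 0" "\<delta> 0 = 0"
    using aut der unfolding ring_automorphism_def skew_derivation_def
    by (metis add_cancel_right_right)+
  have "\<delta> (1 * 1) = \<sigma> 1 * \<delta> 1 + \<delta> 1 * 1" using der unfolding skew_derivation_def by blast
  thus "\<delta> 1 = 0" using aut by (simp add: ring_automorphism_def)
qed

lemma coeff_ore_X_mult:
  "coeff (ore_X_mult \<sigma> \<delta> g) n = (case n of 0 \<Rightarrow> 0 | Suc m \<Rightarrow> \<sigma> (coeff g m)) + \<delta> (coeff g n)"
  by (auto simp: ore_X_mult_def coeff_map_poly ore_map_zero coeff_pCons split: nat.splits)

lemma ore_X_mult_add: "ore_X_mult \<sigma> \<delta> (g + h) = ore_X_mult \<sigma> \<delta> g + ore_X_mult \<sigma> \<delta> h"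
  using aut der
  by (intro poly_eqI)
     (auto simp: coeff_ore_X_mult ring_automorphism_def skew_derivation_def split: nat.splits)

lemma ore_X_mult_zero: "ore_X_mult \<sigma> \<delta> 0 = 0"
  by (simp add: ore_X_mult_def)

lemma ore_X_mult_sum: "ore_X_mult \<sigma> \<delta> (\<Sum>i\<in>A. p i) = (\<Sum>i\<in>A. ore_X_mult \<sigma> \<delta> (p i))"
  by (induction A rule: infinite_finite_induct) (simp_all add: ore_X_mult_add ore_X_mult_zero)

lemma ore_X_mult_lscale:
  "ore_X_mult \<sigma> \<delta> (lscale a g) = lscale (\<sigma> a) (ore_X_mult \<sigma> \<delta> g) + lscale (\<delta> a) g"
  using aut der
  by (intro poly_eqI)
     (auto simp: coeff_ore_X_mult ring_automorphism_def skew_derivation_def algebra_simps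
           split: nat.splits)

lemma ore_X_mult_monom: "ore_X_mult \<sigma> \<delta> (monom b n) = monom (\<sigma> b) (Suc n) + monom (\<delta> b) n"
  by (simp add: ore_X_mult_def map_poly_monom ore_map_zero monom_Suc)

lemma ore_X_pow_add:
  "(ore_X_mult \<sigma> \<delta> ^^ n) (g + h) = (ore_X_mult \<sigma> \<delta> ^^ n) g + (ore_X_mult \<sigma> \<delta> ^^ n) h"
  by (induction n) (simp_all add: ore_X_mult_add)

lemma ore_X_pow_monom: "(ore_X_mult \<sigma> \<delta> ^^ n) (monom 1 m) = monom 1 (n + m)"
  using aut
  by (induction n) (simp_all add: ore_X_mult_monom ore_map_zero ring_automorphism_def)

lemma ore_mult_ore_X_mult:
  "ore_mult \<sigma> \<delta> (ore_X_mult \<sigma> \<delta> g) h = ore_X_mult \<sigma> \<delta> (ore_mult \<sigma> \<delta> g h)"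
proof -
  have *: "ore_mult \<sigma> \<delta> (ore_X_mult \<sigma> \<delta> (monom b n)) h
      = ore_X_mult \<sigma> \<delta> (ore_mult \<sigma> \<delta> (monom b n) h)" for b n
    by (simp add: ore_X_mult_monom ore_mult_add_left ore_mult_monom ore_X_mult_lscale)
  have "ore_mult \<sigma> \<delta> (ore_X_mult \<sigma> \<delta> (\<Sum>i\<le>degree g. monom (coeff g i) i)) h
      = ore_X_mult \<sigma> \<delta> (ore_mult \<sigma> \<delta> (\<Sum>i\<le>degree g. monom (coeff g i) i) h)"
    by (simp add: ore_X_mult_sum ore_mult_sum_left *)
  thus ?thesis by (simp add: poly_as_sum_of_monoms)
qed

lemma ore_mult_ore_X_pow:
  "ore_mult \<sigma> \<delta> ((ore_X_mult \<sigma> \<delta> ^^ n) g) h = (ore_X_mult \<sigma> \<delta> ^^ n) (ore_mult \<sigma> \<delta> g h)"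
  by (induction n) (simp_all add: ore_mult_ore_X_mult)

lemma ring_ore_ring: "ring (ore_ring \<sigma> \<delta>)"
proof (rule ringI)
  show "abelian_group (ore_ring \<sigma> \<delta>)"
  proof (rule abelian_groupI)
    fix x assume "x \<in> carrier (ore_ring \<sigma> \<delta>)"
    show "\<exists>y\<in>carrier (ore_ring \<sigma> \<delta>). y \<oplus>\<^bsub>ore_ring \<sigma> \<delta>\<^esub> x = \<zero>\<^bsub>ore_ring \<sigma> \<delta>\<^esub>"
      by (rule bexI[of _ "- x"]) (simp_all add: ore_ring_def)
  qed (simp_all add: ore_ring_def algebra_simps)
  show "Group.monoid (ore_ring \<sigma> \<delta>)"
  proof
    fix x y z
    have "ore_mult \<sigma> \<delta> (ore_mult \<sigma> \<delta> x y) z = ore_mult \<sigma> \<delta> x (ore_mult \<sigma> \<delta> y z)"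
      by (simp add: ore_mult_def[of \<sigma> \<delta> x] ore_mult_sum_left ore_mult_lscale_left
          ore_mult_ore_X_pow)
    thus "x \<otimes>\<^bsub>ore_ring \<sigma> \<delta>\<^esub> y \<otimes>\<^bsub>ore_ring \<sigma> \<delta>\<^esub> z = x \<otimes>\<^bsub>ore_ring \<sigma> \<delta>\<^esub> (y \<otimes>\<^bsub>ore_ring \<sigma> \<delta>\<^esub> z)"
      by (simp add: ore_ring_def)
    have "ore_mult \<sigma> \<delta> x (monom 1 0) = (\<Sum>i\<le>degree x. monom (coeff x i) i)"
      unfolding ore_mult_def
    proof (rule sum.cong)
      fix i show "lscale (coeff x i) ((ore_X_mult \<sigma> \<delta> ^^ i) (monom 1 0)) = monom (coeff x i) i"
        unfolding ore_X_pow_monom by (rule poly_eqI) simp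
    qed simp
    thus "x \<otimes>\<^bsub>ore_ring \<sigma> \<delta>\<^esub> \<one>\<^bsub>ore_ring \<sigma> \<delta>\<^esub> = x"
      by (simp add: ore_ring_def poly_as_sum_of_monoms)
    have "ore_mult \<sigma> \<delta> (monom 1 0) x = x"
      unfolding ore_mult_monom by (simp add: lscale_simps)
    thus "\<one>\<^bsub>ore_ring \<sigma> \<delta>\<^esub> \<otimes>\<^bsub>ore_ring \<sigma> \<delta>\<^esub> x = x"
      by (simp add: ore_ring_def)
  qed (simp_all add: ore_ring_def)
  fix x y z
  show "(x \<oplus>\<^bsub>ore_ring \<sigma> \<delta>\<^esub> y) \<otimes>\<^bsub>ore_ring \<sigma> \<delta>\<^esub> z
      = x \<otimes>\<^bsub>ore_ring \<sigma> \<delta>\<^esub> z \<oplus>\<^bsub>ore_ring \<sigma> \<delta>\<^esub> y \<otimes>\<^bsub>ore_ring \<sigma> \<delta>\<^esub> z"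
    by (simp add: ore_ring_def ore_mult_add_left)
  show "z \<otimes>\<^bsub>ore_ring \<sigma> \<delta>\<^esub> (x \<oplus>\<^bsub>ore_ring \<sigma> \<delta>\<^esub> y)
      = z \<otimes>\<^bsub>ore_ring \<sigma> \<delta>\<^esub> x \<oplus>\<^bsub>ore_ring \<sigma> \<delta>\<^esub> z \<otimes>\<^bsub>ore_ring \<sigma> \<delta>\<^esub> y"
    by (simp add: ore_ring_def ore_mult_def ore_X_pow_add lscale_simps sum.distrib)
qed

lemma ore_X_commutation:
  "monom 1 1 \<otimes>\<^bsub>ore_ring \<sigma> \<delta>\<^esub> monom a 0
     = monom (\<sigma> a) 0 \<otimes>\<^bsub>ore_ring \<sigma> \<delta>\<^esub> monom 1 1 \<oplus>\<^bsub>ore_ring \<sigma> \<delta>\<^esub> monom (\<delta> a) 0"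
proof -
  have "lscale b (monom 1 1) = monom b 1" for b :: 'a by (rule poly_eqI) simp
  thus ?thesis
    unfolding ore_ring_def by (simp add: ore_mult_monom ore_X_mult_monom lscale_simps)
qed

lemma ore_left_basis:
  "f = (\<Sum>i\<le>degree f. monom (coeff f i) 0 \<otimes>\<^bsub>ore_ring \<sigma> \<delta>\<^esub> monom 1 i)"
proof -
  have "lscale b (monom 1 i) = monom b i" for b :: 'a and i by (rule poly_eqI) simp
  thus ?thesis by (simp add: ore_ring_def ore_mult_monom poly_as_sum_of_monoms)
qed

lemma ore_left_independent:
  "coeff (\<Sum>i\<le>n. monom (c i) 0 \<otimes>\<^bsub>ore_ring \<sigma> \<delta>\<^esub> monom 1 i) k = (if k \<le> n then c k else 0)"
proof -
  have "lscale b (monom 1 i) = monom b i" for b :: 'a and i by (rule poly_eqI) simp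
  thus ?thesis by (simp add: ore_ring_def ore_mult_monom coeff_sum)
qed

lemma ore_X_power: "monom 1 1 [^]\<^bsub>ore_ring \<sigma> \<delta>\<^esub> n = monom 1 n"
proof -
  have "ore_mult \<sigma> \<delta> (monom 1 n) (monom 1 1) = monom 1 (Suc n)" for n
    unfolding ore_mult_monom ore_X_pow_monom by (simp add: lscale_simps)
  thus ?thesis
    by (induction n) (simp_all add: nat_pow_def ore_ring_def)
qed

end

end

theory Submission
  imports Defs
begin

text \<open>
  Let \<open>c = f\<^sup>*\<close>, and let \<open>M\<close> be the left \<open>R\<close>-module of maps \<open>y \<mapsto> \<Sum> g\<^sub>k y f\<^sup>k\<close> on \<open>R\<close>, a copy of
  \<open>R \<otimes>\<^sub>C C[f]\<close>. Take a minimal finite set \<open>Y\<close> of points such that evaluation at \<open>Y\<close> is injective on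
  \<open>M\<close>, and put \<open>d = |Y|\<close>. By minimality there are maps in \<open>M\<close> dual to \<open>Y\<close> up to a central denominator
  \<open>b\<close>. They force \<open>1, f, \<dots>, f\<^sup>d\<^sup>-\<^sup>1\<close> to be \<open>C\<close>-independent (else \<open>M\<close> would have rank below \<open>d\<close>), and then
  the \<open>d\<^sup>2\<close> elements \<open>y f\<^sup>k\<close> to be \<open>C\<close>-independent, so \<open>d\<^sup>2 \<le> r\<close>.

  Since \<open>R\<close> has a \<open>C\<close>-basis and \<open>C \<inter> Rf \<subseteq> Rc\<close>, a map \<open>y \<mapsto> \<Sum>\<^sub>l h\<^sub>l y f\<^sup>l\<close> (\<open>l < m\<close>) with all
  \<open>deg h\<^sub>l < deg c\<close> lies in \<open>M f\<^sup>m\<close> only if it vanishes; these maps form a \<open>D\<close>-space of dimension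
  \<open>m deg c\<close>. On the other hand, evaluating at \<open>Y\<close> one sees that a \<open>D\<close>-space of such maps of dimension
  more than \<open>d (m deg f + deg b)\<close> meets \<open>M f\<^sup>m\<close>. Letting \<open>m\<close> grow gives \<open>deg c \<le> d deg f\<close>.
\<close>

section \<open>Linear systems over Ore domains\<close>

text \<open>
  The type of Ore polynomials carries no multiplicative type class, so the product is a locale
  parameter; only the additive structure comes from the type.
\<close>

locale mult_domain =
  fixes mul :: "'r::ab_group_add \<Rightarrow> 'r \<Rightarrow> 'r" (infixl "\<star>" 70) and u :: 'r
  assumes mul_assoc: "a \<star> b \<star> c = a \<star> (b \<star> c)"
    and mul_add_left: "(a + b) \<star> c = a \<star> c + b \<star> c"
    and mul_add_right: "a \<star> (b + c) = a \<star> b + a \<star> c"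
    and unit_left [simp]: "u \<star> a = a"
    and unit_right [simp]: "a \<star> u = a"
    and no_zero_div: "a \<star> b = 0 \<Longrightarrow> a = 0 \<or> b = 0"
    and unit_nonzero [simp]: "u \<noteq> 0"
begin

lemma mul_zero [simp]: "0 \<star> a = 0" "a \<star> 0 = 0"
  using mul_add_left[of 0 0 a] mul_add_right[of a 0 0] by auto

lemma mul_eq_0_iff [simp]: "a \<star> b = 0 \<longleftrightarrow> a = 0 \<or> b = 0"
  using no_zero_div by auto

lemma mul_minus_left: "(- a) \<star> b = - (a \<star> b)"
  using mul_add_left[of a "- a" b] by (simp add: eq_neg_iff_add_eq_0 add.commute)

lemma mul_minus_right: "a \<star> (- b) = - (a \<star> b)"
  using mul_add_right[of a b "- b"] by (simp add: eq_neg_iff_add_eq_0 add.commute)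

lemma mul_diff_left: "(a - b) \<star> c = a \<star> c - b \<star> c"
  using mul_add_left[of a "- b" c] by (simp add: mul_minus_left)

lemma mul_diff_right: "a \<star> (b - c) = a \<star> b - a \<star> c"
  using mul_add_right[of a b "- c"] by (simp add: mul_minus_right)

lemma mul_sum_left: "(\<Sum>i\<in>A. g i) \<star> a = (\<Sum>i\<in>A. g i \<star> a)"
  by (induction A rule: infinite_finite_induct) (simp_all add: mul_add_left)

lemma mul_sum_right: "a \<star> (\<Sum>i\<in>A. g i) = (\<Sum>i\<in>A. a \<star> g i)"
  by (induction A rule: infinite_finite_induct) (simp_all add: mul_add_right)

lemma mul_cancel_right: "a \<star> c = b \<star> c \<Longrightarrow> c \<noteq> 0 \<Longrightarrow> a = b"
  using mul_eq_0_iff[of "a - b" c] by (simp add: mul_diff_left)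

lemma mul_cancel_left: "c \<star> a = c \<star> b \<Longrightarrow> c \<noteq> 0 \<Longrightarrow> a = b"
  using mul_eq_0_iff[of c "a - b"] by (simp add: mul_diff_right)

primrec pw :: "'r \<Rightarrow> nat \<Rightarrow> 'r" where
  "pw a 0 = u"
| "pw a (Suc n) = pw a n \<star> a"

lemma pw_add: "pw a (m + n) = pw a m \<star> pw a n"
  by (induction n) (simp_all add: mul_assoc)

lemma pw_nonzero: "a \<noteq> 0 \<Longrightarrow> pw a n \<noteq> 0"
  by (induction n) simp_all

text \<open>The last clause is the left Ore condition, which stands in for division when a pivot is
  eliminated. It is met by the center, by the whole of R and by the coefficient skew field
  D.\<close>

definition ore_subring :: "'r set \<Rightarrow> bool" where
  "ore_subring S \<longleftrightarrow> u \<in> S \<and> (\<forall>a\<in>S. \<forall>b\<in>S. a - b \<in> S \<and> a \<star> b \<in> S) \<and>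
     (\<forall>a\<in>S. \<forall>b\<in>S. b \<noteq> 0 \<longrightarrow> (\<exists>p\<in>S. \<exists>q\<in>S. p \<noteq> 0 \<and> p \<star> a = q \<star> b))"

lemma ore_subring_sum:
  assumes "ore_subring S" "\<And>i. i \<in> A \<Longrightarrow> g i \<in> S"
  shows "(\<Sum>i\<in>A. g i) \<in> S" "- (\<Sum>i\<in>A. g i) \<in> S"
proof -
  have "u - u \<in> S" using assms(1) unfolding ore_subring_def by blast
  hence z: "0 \<in> S" by simp
  have n: "- a \<in> S" if "a \<in> S" for a
  proof -
    have "0 - a \<in> S" using assms(1) z that unfolding ore_subring_def by blast
    thus ?thesis by simp
  qed
  have "a + b \<in> S" if "a \<in> S" "b \<in> S" for a b
  proof -
    have "a - (- b) \<in> S" using assms(1) that n unfolding ore_subring_def by blast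
    thus ?thesis by simp
  qed
  with assms(2) show "(\<Sum>i\<in>A. g i) \<in> S"
    by (induction A rule: infinite_finite_induct) (simp_all add: z)
  thus "- (\<Sum>i\<in>A. g i) \<in> S" by (rule n)
qed

text \<open>Gaussian elimination without inverses: a row with a nonzero entry in column
  \<open>j\<close> is the pivot, the Ore condition clears that column in the other rows, and
  induction solves the system with one unknown and one equation fewer.\<close>

lemma more_unknowns_than_equations:
  assumes S: "ore_subring S" and "finite J" "finite I" "card J < card I"
    and "\<forall>i\<in>I. \<forall>j\<in>J. v i j \<in> S"
  shows "\<exists>g. (\<forall>i\<in>I. g i \<in> S) \<and> (\<exists>i\<in>I. g i \<noteq> 0) \<and> (\<forall>j\<in>J. (\<Sum>i\<in>I. g i \<star> v i j) = 0)"
  using assms(2-)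
proof (induction J arbitrary: I v rule: finite_induct)
  case empty
  hence "\<exists>i. i \<in> I" by (metis card_gt_0_iff card.empty ex_in_conv)
  thus ?case using S by (intro exI[of _ "\<lambda>_. u"]) (auto simp: ore_subring_def)
next
  case (insert j J)
  show ?case
  proof (cases "\<forall>i\<in>I. v i j = 0")
    case True
    have "\<exists>g. (\<forall>i\<in>I. g i \<in> S) \<and> (\<exists>i\<in>I. g i \<noteq> 0) \<and> (\<forall>j\<in>J. (\<Sum>i\<in>I. g i \<star> v i j) = 0)"
      using insert.prems insert.hyps by (intro insert.IH) auto
    with True show ?thesis by auto
  next
    case False
    then obtain i0 where i0: "i0 \<in> I" "v i0 j \<noteq> 0" by blast
    let ?I = "I - {i0}"
    have "\<forall>i\<in>?I. \<exists>p q. p \<in> S \<and> q \<in> S \<and> p \<noteq> 0 \<and> p \<star> v i j = q \<star> v i0 j"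
      using S i0 insert.prems(3) unfolding ore_subring_def by (metis DiffD1 insertI1)
    then obtain p q where pq: "\<And>i. i \<in> ?I \<Longrightarrow> p i \<in> S" "\<And>i. i \<in> ?I \<Longrightarrow> q i \<in> S"
      "\<And>i. i \<in> ?I \<Longrightarrow> p i \<noteq> 0" "\<And>i. i \<in> ?I \<Longrightarrow> p i \<star> v i j = q i \<star> v i0 j"
      by metis
    define w where "w i k = p i \<star> v i k - q i \<star> v i0 k" for i k
    have "\<exists>h. (\<forall>i\<in>?I. h i \<in> S) \<and> (\<exists>i\<in>?I. h i \<noteq> 0) \<and> (\<forall>k\<in>J. (\<Sum>i\<in>?I. h i \<star> w i k) = 0)"
    proof (rule insert.IH)
      show "finite ?I" "card J < card ?I"
        using insert.prems insert.hyps i0 by auto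
      show "\<forall>i\<in>?I. \<forall>k\<in>J. w i k \<in> S"
        unfolding w_def using S pq(1,2) insert.prems(3) i0(1)
        by (auto simp: ore_subring_def)
    qed
    then obtain h where h: "\<And>i. i \<in> ?I \<Longrightarrow> h i \<in> S" "\<exists>i\<in>?I. h i \<noteq> 0"
      "\<And>k. k \<in> J \<Longrightarrow> (\<Sum>i\<in>?I. h i \<star> w i k) = 0" by blast
    \<comment> \<open>The value at \<open>i0\<close> collects the subtracted multiples of the pivot
      row, so \<open>g\<close> combines the rows of \<open>v\<close> exactly as \<open>h\<close>
      combines those of \<open>w\<close>.\<close>
    define g where "g i = (if i = i0 then - (\<Sum>i\<in>?I. h i \<star> q i) else h i \<star> p i)" for i
    have hq: "h i \<star> q i \<in> S" "h i \<star> p i \<in> S" if "i \<in> ?I" for i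
      using S h(1)[OF that] pq(1,2)[OF that] by (auto simp: ore_subring_def)
    have "g i \<in> S" if "i \<in> I" for i
      using that ore_subring_sum(2)[OF S, of ?I "\<lambda>i. h i \<star> q i"] hq by (auto simp: g_def)
    moreover have "\<exists>i\<in>I. g i \<noteq> 0"
    proof -
      obtain i where "i \<in> ?I" "h i \<noteq> 0" using h(2) by blast
      hence "g i \<noteq> 0" using pq(3) by (simp add: g_def)
      with \<open>i \<in> ?I\<close> show ?thesis by blast
    qed
    moreover have "(\<Sum>i\<in>I. g i \<star> v i k) = 0" if k: "k \<in> insert j J" for k
    proof -
      have "(\<Sum>i\<in>I. g i \<star> v i k) = g i0 \<star> v i0 k + (\<Sum>i\<in>?I. g i \<star> v i k)"
        using insert.prems(1) i0(1) by (simp add: sum.remove)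
      also have "(\<Sum>i\<in>?I. g i \<star> v i k) = (\<Sum>i\<in>?I. h i \<star> (p i \<star> v i k))"
        by (intro sum.cong) (auto simp: g_def mul_assoc)
      also have "g i0 \<star> v i0 k = - (\<Sum>i\<in>?I. h i \<star> (q i \<star> v i0 k))"
        by (simp add: g_def mul_minus_left mul_sum_left mul_assoc)
      also have "- (\<Sum>i\<in>?I. h i \<star> (q i \<star> v i0 k)) + (\<Sum>i\<in>?I. h i \<star> (p i \<star> v i k))
          = (\<Sum>i\<in>?I. h i \<star> w i k)"
        by (simp add: w_def mul_diff_right sum_subtractf)
      also have "\<dots> = 0"
      proof (cases "k = j")
        case True
        thus ?thesis using pq(4) by (auto simp: w_def intro!: sum.neutral)
      qed (use k h(3) in auto)
      finally show ?thesis .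
    qed
    ultimately show ?thesis by blast
  qed
qed

section \<open>Domains that are free over their center\<close>

definition center :: "'r set" where
  "center = {c. \<forall>x. c \<star> x = x \<star> c}"

lemma centerD: "c \<in> center \<Longrightarrow> c \<star> x = x \<star> c"
  by (simp add: center_def)

lemma center_left_commute: "c \<in> center \<Longrightarrow> x \<star> (c \<star> y) = c \<star> (x \<star> y)"
  by (metis centerD mul_assoc)

lemma center_closed:
  "u \<in> center" "0 \<in> center"
  "a \<in> center \<Longrightarrow> b \<in> center \<Longrightarrow> a + b \<in> center"
  "a \<in> center \<Longrightarrow> b \<in> center \<Longrightarrow> a - b \<in> center"
  "a \<in> center \<Longrightarrow> b \<in> center \<Longrightarrow> a \<star> b \<in> center"
  "a \<in> center \<Longrightarrow> - a \<in> center"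
proof -
  show "a \<star> b \<in> center" if "a \<in> center" "b \<in> center"
    using that unfolding center_def mem_Collect_eq by (metis mul_assoc)
qed (auto simp: center_def mul_add_left mul_add_right mul_diff_left mul_diff_right
       mul_minus_left mul_minus_right)

lemma ore_subring_center: "ore_subring center"
proof -
  have "\<exists>p\<in>center. \<exists>q\<in>center. p \<noteq> 0 \<and> p \<star> a = q \<star> b"
    if "a \<in> center" "b \<in> center" "b \<noteq> 0" for a b
    using that centerD[of b a] by (intro bexI[of _ b] bexI[of _ a]) auto
  thus ?thesis by (simp add: ore_subring_def center_closed)
qed

end

locale central_free_domain = mult_domain +
  fixes r :: nat and e :: "nat \<Rightarrow> 'a"
  assumes basis_span: "\<exists>c. (\<forall>i<r. c i \<in> center) \<and> x = (\<Sum>i<r. c i \<star> e i)"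
    and basis_indep: "(\<forall>i<r. c i \<in> center) \<Longrightarrow> (\<Sum>i<r. c i \<star> e i) = 0 \<Longrightarrow> i < r \<Longrightarrow> c i = 0"
begin

text \<open>Coordinates of the \<open>x i\<close> in the basis give \<open>r\<close> linear
  equations over the commutative ring \<open>center\<close>, where elimination applies.\<close>

lemma center_dependent:
  assumes "finite I" "r < card I"
  shows "\<exists>g. (\<forall>i\<in>I. g i \<in> center) \<and> (\<exists>i\<in>I. g i \<noteq> 0) \<and> (\<Sum>i\<in>I. g i \<star> x i) = 0"
proof -
  have "\<forall>i. \<exists>c. (\<forall>j<r. c j \<in> center) \<and> x i = (\<Sum>j<r. c j \<star> e j)"
    using basis_span by blast
  from choice[OF this] obtain v
    where v: "\<And>i j. j < r \<Longrightarrow> v i j \<in> center" "\<And>i. x i = (\<Sum>j<r. v i j \<star> e j)"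
    by blast
  have "card {..<r} < card I" "\<forall>i\<in>I. \<forall>j\<in>{..<r}. v i j \<in> center"
    using assms v(1) by auto
  from more_unknowns_than_equations[OF ore_subring_center finite_lessThan assms(1) this]
  obtain g where g: "\<forall>i\<in>I. g i \<in> center" "\<exists>i\<in>I. g i \<noteq> 0"
    "\<And>j. j \<in> {..<r} \<Longrightarrow> (\<Sum>i\<in>I. g i \<star> v i j) = 0" by blast
  have "(\<Sum>i\<in>I. g i \<star> x i) = (\<Sum>i\<in>I. \<Sum>j<r. g i \<star> v i j \<star> e j)"
    by (subst v(2)) (simp add: mul_sum_right mul_assoc)
  also have "\<dots> = (\<Sum>j<r. (\<Sum>i\<in>I. g i \<star> v i j) \<star> e j)"
    by (subst sum.swap) (simp add: mul_sum_left)
  also have "\<dots> = 0" using g(3) by simp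
  finally show ?thesis using g by blast
qed

text \<open>The \<open>r + 1\<close> powers of \<open>g\<close> up to \<open>pw g r\<close> satisfy
  a central relation. Cancelling its lowest power leaves a nonzero central constant term, and all
  other terms are left multiples of \<open>g\<close>.\<close>

lemma central_multiple:
  assumes "g \<noteq> 0"
  shows "\<exists>v. v \<star> g \<in> center \<and> v \<star> g \<noteq> 0"
proof -
  have "r < card {..r}" by simp
  from center_dependent[OF finite_atMost this, of "pw g"] obtain c
    where c: "\<forall>i\<in>{..r}. c i \<in> center" "\<exists>i\<in>{..r}. c i \<noteq> 0" "(\<Sum>i\<in>{..r}. c i \<star> pw g i) = 0"
    by blast
  define j where "j = (LEAST i. c i \<noteq> 0)"
  obtain k where k: "k \<le> r" "c k \<noteq> 0" using c(2) by auto
  have j: "c j \<noteq> 0" unfolding j_def by (rule LeastI[of _ k]) (rule k(2))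
  have below: "c i = 0" if "i < j" for i
    using that not_less_Least[of i "\<lambda>i. c i \<noteq> 0"] unfolding j_def by simp
  have "j \<le> k" unfolding j_def by (rule Least_le) (rule k(2))
  with k(1) have jr: "j \<le> r" by simp
  have "(\<Sum>i\<le>r. c i \<star> pw g i) = (\<Sum>i\<in>{j..r}. c i \<star> pw g i)"
    by (intro sum.mono_neutral_right) (auto simp: below)
  also have "\<dots> = c j \<star> pw g j + (\<Sum>i\<in>{Suc j..r}. c i \<star> pw g i)"
    using jr by (simp add: sum.atLeast_Suc_atMost)
  also have "(\<Sum>i\<in>{Suc j..r}. c i \<star> pw g i)
      = (\<Sum>i\<in>{Suc j..r}. c i \<star> pw g (i - Suc j)) \<star> g \<star> pw g j"
    unfolding mul_sum_left
  proof (rule sum.cong)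
    fix i assume "i \<in> {Suc j..r}"
    hence "i = (i - Suc j) + Suc 0 + j" by simp
    hence "pw g i = pw g (i - Suc j) \<star> pw g (Suc 0) \<star> pw g j" by (metis pw_add)
    thus "c i \<star> pw g i = c i \<star> pw g (i - Suc j) \<star> g \<star> pw g j"
      by (simp add: mul_assoc)
  qed simp
  finally have "(c j + (\<Sum>i\<in>{Suc j..r}. c i \<star> pw g (i - Suc j)) \<star> g) \<star> pw g j = 0"
    using c(3) by (simp add: mul_add_left)
  hence "c j + (\<Sum>i\<in>{Suc j..r}. c i \<star> pw g (i - Suc j)) \<star> g = 0"
    using pw_nonzero[OF assms] by simp
  hence "(- (\<Sum>i\<in>{Suc j..r}. c i \<star> pw g (i - Suc j))) \<star> g = c j"
    unfolding mul_minus_left by (intro minus_unique) (simp only: add.commute)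
  moreover have "c j \<in> center" using c(1) jr by simp
  ultimately show ?thesis
    using j by (intro exI[of _ "- (\<Sum>i\<in>{Suc j..r}. c i \<star> pw g (i - Suc j))"]) simp
qed

text \<open>If \<open>v \<star> b\<close> is central and nonzero, then
  \<open>(v \<star> b) \<star> a = (a \<star> v) \<star> b\<close>, which is the Ore
  condition.\<close>

lemma ore_subring_UNIV: "ore_subring UNIV"
proof -
  have "\<exists>p q. p \<noteq> 0 \<and> p \<star> a = q \<star> b" if b: "b \<noteq> 0" for a b
  proof -
    obtain v where v: "v \<star> b \<in> center" "v \<star> b \<noteq> 0" using central_multiple[OF b] by blast
    have "v \<star> b \<star> a = a \<star> v \<star> b" using centerD[OF v(1), of a] by (simp add: mul_assoc)
    with v(2) show ?thesis by blast
  qed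
  thus ?thesis by (simp add: ore_subring_def)
qed

text \<open>
  The argument is the one for independence of characters: from a shortest relation one eliminates
  a term, so all \<open>s i\<close> are proportional to one of them over the center.
\<close>

lemma bimodule_independence:
  assumes rel: "\<And>y. (\<Sum>i<r. e i \<star> y \<star> s i) = 0" and "i < r"
  shows "s i = 0"
proof -
  have "\<forall>i\<in>I. s i = 0"
    if "finite I" "I \<subseteq> {..<r}" "\<And>y. (\<Sum>i\<in>I. e i \<star> y \<star> s i) = 0" for I s
    using that
  proof (induction "card I" arbitrary: I s)
    case 0
    thus ?case by simp
  next
    case (Suc n)
    show ?case
    proof (rule ccontr)
      assume "\<not> (\<forall>i\<in>I. s i = 0)"
      then obtain k where k: "k \<in> I" "s k \<noteq> 0" by blast
      have comm: "s k \<star> z \<star> s i = s i \<star> z \<star> s k" if "i \<in> I" for z i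
      proof (cases "i = k")
        case False
        \<comment> \<open>Substituting \<open>y \<star> s k \<star> z\<close> for \<open>y\<close>,
          or multiplying on the right by \<open>z \<star> s k\<close>, gives two relations that
          agree at index \<open>k\<close>. Their difference has the coefficients \<open>t i\<close>
          and is shorter.\<close>
        define t where "t i = s k \<star> z \<star> s i - s i \<star> z \<star> s k" for i
        have "\<forall>i\<in>I - {k}. t i = 0"
        proof (rule Suc.hyps(1))
          show "n = card (I - {k})" using Suc.hyps(2) k Suc.prems(1) by simp
          show "finite (I - {k})" "I - {k} \<subseteq> {..<r}" using Suc.prems by auto
          fix y
          have "(\<Sum>i\<in>I - {k}. e i \<star> y \<star> t i) = (\<Sum>i\<in>I. e i \<star> y \<star> t i)"
            using Suc.prems(1) k by (simp add: sum.remove t_def)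
          also have "\<dots> = (\<Sum>i\<in>I. e i \<star> (y \<star> s k \<star> z) \<star> s i)
              - (\<Sum>i\<in>I. e i \<star> y \<star> s i) \<star> (z \<star> s k)"
            by (simp add: t_def mul_diff_right sum_subtractf mul_sum_left mul_assoc)
          also have "\<dots> = 0" using Suc.prems(3) by simp
          finally show "(\<Sum>i\<in>I - {k}. e i \<star> y \<star> t i) = 0" .
        qed
        thus ?thesis using that False by (simp add: t_def)
      qed simp
      obtain v where v: "v \<star> s k \<in> center" "v \<star> s k \<noteq> 0" using central_multiple[OF k(2)] by blast
      have kv: "s k \<star> v = v \<star> s k"
      proof (rule mul_cancel_right[OF _ k(2)])
        show "s k \<star> v \<star> s k = v \<star> s k \<star> s k"
          using centerD[OF v(1), of "s k"] by (simp add: mul_assoc)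
      qed
      \<comment> \<open>By \<open>comm\<close>, the factor \<open>v\<close> that carries
        \<open>s k\<close> into the center does so for every \<open>s i\<close>.\<close>
      have c: "v \<star> s i \<in> center" if "i \<in> I" for i
      proof -
        have "z \<star> (v \<star> s i) = v \<star> s i \<star> z" for z
        proof (rule mul_cancel_left[OF _ v(2)])
          have "v \<star> s k \<star> (z \<star> (v \<star> s i)) = v \<star> (s k \<star> (z \<star> v) \<star> s i)"
            by (simp add: mul_assoc)
          also have "\<dots> = v \<star> s i \<star> z \<star> (v \<star> s k)"
            using comm[OF that, of "z \<star> v"] by (simp add: mul_assoc)
          also have "\<dots> = v \<star> s k \<star> (v \<star> s i \<star> z)"
            using centerD[OF v(1)] by simp
          finally show "v \<star> s k \<star> (z \<star> (v \<star> s i)) = v \<star> s k \<star> (v \<star> s i \<star> z)" .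
        qed
        thus ?thesis by (simp add: center_def)
      qed
      \<comment> \<open>The relation at \<open>y = u\<close>, multiplied by
        \<open>v \<star> s k\<close>, becomes a central relation between the basis elements times
        \<open>s k\<close>. Its coefficient at \<open>k\<close> is nonzero, against
        \<open>basis_indep\<close>.\<close>
      have "(\<Sum>i\<in>I. v \<star> s i \<star> e i) \<star> s k = (\<Sum>i\<in>I. e i \<star> u \<star> s i) \<star> (v \<star> s k)"
        unfolding mul_sum_left
      proof (rule sum.cong)
        fix i assume i: "i \<in> I"
        have "v \<star> s i \<star> e i \<star> s k = e i \<star> (s k \<star> (v \<star> s i))"
          using c[OF i] by (metis centerD mul_assoc)
        also have "s k \<star> (v \<star> s i) = s i \<star> (v \<star> s k)"
          using comm[OF i, of v] by (simp add: mul_assoc)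
        finally show "v \<star> s i \<star> e i \<star> s k = e i \<star> u \<star> s i \<star> (v \<star> s k)"
          by (simp add: mul_assoc)
      qed simp
      hence "(\<Sum>i\<in>I. v \<star> s i \<star> e i) = 0" using Suc.prems(3)[of u] k(2) by simp
      moreover have "(\<Sum>i\<in>I. v \<star> s i \<star> e i) = (\<Sum>i<r. (if i \<in> I then v \<star> s i else 0) \<star> e i)"
        using Suc.prems(2) by (intro sum.mono_neutral_cong_left) auto
      ultimately have "(if k \<in> I then v \<star> s k else 0) = 0"
        using Suc.prems(2) k c center_closed(2)
        by (intro basis_indep[where c = "\<lambda>i. if i \<in> I then v \<star> s i else 0"]) auto
      thus False using k v by simp
    qed
  qed
  from this[of "{..<r}" s] show ?thesis using assms by auto
qed

end

text \<open>
  The module \<open>M\<close>, in the form of the left module \<open>R \<otimes>\<^sub>C C[f]\<close> acting on \<open>R\<close>.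
\<close>

inductive_set (in mult_domain) eval_maps :: "'r \<Rightarrow> ('r \<Rightarrow> 'r) set" for f where
  base: "(\<lambda>y. g \<star> y \<star> pw f k) \<in> eval_maps f"
| add: "G \<in> eval_maps f \<Longrightarrow> H \<in> eval_maps f \<Longrightarrow> (\<lambda>y. G y + H y) \<in> eval_maps f"

section \<open>The module of evaluation maps\<close>

context central_free_domain
begin

lemma eval_maps_zero: "(\<lambda>y. 0) \<in> eval_maps f"
  using eval_maps.base[of 0 f 0] by simp

lemma eval_maps_left_mult: "G \<in> eval_maps f \<Longrightarrow> (\<lambda>y. a \<star> G y) \<in> eval_maps f"
proof (induction rule: eval_maps.induct)
  case (base g k)
  show ?case using eval_maps.base[of "a \<star> g" f k] by (simp add: mul_assoc)
next
  case (add G H)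
  thus ?case using eval_maps.add[OF add.IH] by (simp add: mul_add_right)
qed

lemma eval_maps_right_mult: "G \<in> eval_maps f \<Longrightarrow> (\<lambda>y. G y \<star> pw f n) \<in> eval_maps f"
proof (induction rule: eval_maps.induct)
  case (base g k)
  show ?case using eval_maps.base[of g f "k + n"] by (simp add: mul_assoc pw_add)
next
  case (add G H)
  thus ?case using eval_maps.add[OF add.IH] by (simp add: mul_add_left)
qed

lemma eval_maps_diff:
  assumes "G \<in> eval_maps f" "H \<in> eval_maps f"
  shows "(\<lambda>y. G y - H y) \<in> eval_maps f"
  using eval_maps.add[OF assms(1) eval_maps_left_mult[OF assms(2), of "- u"]]
  by (simp add: mul_minus_left)

lemma eval_maps_sum:
  "(\<And>i. i \<in> A \<Longrightarrow> G i \<in> eval_maps f) \<Longrightarrow> (\<lambda>y. \<Sum>i\<in>A. G i y) \<in> eval_maps f"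
  by (induction A rule: infinite_finite_induct) (simp_all add: eval_maps_zero eval_maps.add)

lemma eval_maps_linear:
  assumes "G \<in> eval_maps f"
  shows "G (x + y) = G x + G y" "c \<in> center \<Longrightarrow> G (c \<star> x) = c \<star> G x"
    "G (x \<star> pw f n) = G x \<star> pw f n"
  using assms
proof (induction rule: eval_maps.induct)
  case (base g k)
  show "g \<star> (x + y) \<star> pw f k = g \<star> x \<star> pw f k + g \<star> y \<star> pw f k"
    by (simp add: mul_add_left mul_add_right)
  show "g \<star> (c \<star> x) \<star> pw f k = c \<star> (g \<star> x \<star> pw f k)" if "c \<in> center"
    using that by (simp add: center_left_commute mul_assoc)
  show "g \<star> (x \<star> pw f n) \<star> pw f k = g \<star> x \<star> pw f k \<star> pw f n"
    by (simp add: mul_assoc flip: pw_add) (simp add: add.commute)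
qed (simp_all add: mul_add_left mul_add_right)

lemma eval_maps_sum_arg:
  assumes "G \<in> eval_maps f"
  shows "G (\<Sum>i\<in>A. x i) = (\<Sum>i\<in>A. G (x i))"
proof -
  have "G 0 = 0" using eval_maps_linear(1)[OF assms, of 0 0] by simp
  thus ?thesis
    by (induction A rule: infinite_finite_induct) (simp_all add: eval_maps_linear[OF assms])
qed

text \<open>The central coordinates of the left factor move across \<open>y\<close> to the right
  factor. This is the shape to which \<open>bimodule_independence\<close> applies.\<close>

lemma eval_maps_basis_form:
  "G \<in> eval_maps f \<Longrightarrow> \<exists>s. \<forall>y. G y = (\<Sum>i<r. e i \<star> y \<star> s i)"
proof (induction rule: eval_maps.induct)
  case (base g k)
  obtain c where c: "\<And>i. i < r \<Longrightarrow> c i \<in> center" "g = (\<Sum>i<r. c i \<star> e i)"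
    using basis_span by metis
  have "g \<star> y \<star> pw f k = (\<Sum>i<r. e i \<star> y \<star> (c i \<star> pw f k))" for y
    unfolding c(2) mul_sum_left
    by (intro sum.cong) (auto simp: mul_assoc center_left_commute[OF c(1)])
  thus ?case by (intro exI[of _ "\<lambda>i. c i \<star> pw f k"]) simp
next
  case (add G H)
  then obtain s t where "\<forall>y. G y = (\<Sum>i<r. e i \<star> y \<star> s i)" "\<forall>y. H y = (\<Sum>i<r. e i \<star> y \<star> t i)"
    by blast
  hence "\<forall>y. G y + H y = (\<Sum>i<r. e i \<star> y \<star> (s i + t i))"
    by (simp add: mul_add_right sum.distrib)
  thus ?case by (intro exI[of _ "\<lambda>i. s i + t i"])
qed

text \<open>Let \<open>h l\<close> be the lowest nonzero coefficient. Every other term contains a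
  higher power of \<open>f\<close>, so cancelling \<open>pw f l\<close> gives
  \<open>h l \<star> y = H y \<star> f\<close> with \<open>H\<close> in M. Comparing coefficients
  over the basis puts the central coordinates of \<open>h l\<close> into R f, hence by
  \<open>ann\<close> into R c.\<close>

lemma coeffs_mod_power:
  assumes "f \<noteq> 0" and ann: "\<And>x a. x \<in> center \<Longrightarrow> x = a \<star> f \<Longrightarrow> \<exists>w. x = w \<star> c"
    and G: "G \<in> eval_maps f"
    and eq: "\<And>y. (\<Sum>l<m. h l \<star> y \<star> pw f l) = G y \<star> pw f m"
    and "l' < m" "h l' \<noteq> 0"
  shows "\<exists>l<m. h l \<noteq> 0 \<and> (\<exists>w. h l = w \<star> c)"
proof -
  define l where "l = (LEAST l. h l \<noteq> 0)"
  have l: "h l \<noteq> 0" unfolding l_def by (rule LeastI[of _ l']) (rule assms(6))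
  have below: "h i = 0" if "i < l" for i
    using that not_less_Least[of i "\<lambda>l. h l \<noteq> 0"] unfolding l_def by simp
  have "l \<le> l'" unfolding l_def by (rule Least_le) (rule assms(6))
  with assms(5) have lm: "l < m" by simp
  define H where "H y = G y \<star> pw f (m - Suc l) - (\<Sum>i\<in>{Suc l..<m}. h i \<star> y \<star> pw f (i - Suc l))" for y
  have H: "H \<in> eval_maps f"
    unfolding H_def by (intro eval_maps_diff eval_maps_right_mult G eval_maps_sum eval_maps.base)
  have shift: "x \<star> pw f i = x \<star> pw f (i - Suc l) \<star> f \<star> pw f l" if "Suc l \<le> i" for i x
  proof -
    have "i = (i - Suc l) + Suc 0 + l" using that by simp
    hence "pw f i = pw f (i - Suc l) \<star> pw f (Suc 0) \<star> pw f l" by (metis pw_add)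
    thus ?thesis by (simp add: mul_assoc)
  qed
  have key: "h l \<star> y = H y \<star> f" for y
  proof (rule mul_cancel_right[OF _ pw_nonzero[OF assms(1), of l]])
    have "(\<Sum>i<m. h i \<star> y \<star> pw f i) = (\<Sum>i\<in>{l..<m}. h i \<star> y \<star> pw f i)"
      by (intro sum.mono_neutral_right) (auto simp: below)
    also have "\<dots> = h l \<star> y \<star> pw f l + (\<Sum>i\<in>{Suc l..<m}. h i \<star> y \<star> pw f i)"
      using lm by (simp add: sum.atLeast_Suc_lessThan)
    also have "(\<Sum>i\<in>{Suc l..<m}. h i \<star> y \<star> pw f i)
        = (\<Sum>i\<in>{Suc l..<m}. h i \<star> y \<star> pw f (i - Suc l)) \<star> f \<star> pw f l"
      unfolding mul_sum_left by (intro sum.cong shift) auto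
    finally show "h l \<star> y \<star> pw f l = H y \<star> f \<star> pw f l"
      using eq[of y] shift[of m "G y"] lm
      by (simp add: H_def mul_diff_left algebra_simps)
  qed
  obtain s where s: "\<And>y. H y = (\<Sum>i<r. e i \<star> y \<star> s i)"
    using eval_maps_basis_form[OF H] by blast
  obtain a where a: "\<And>i. i < r \<Longrightarrow> a i \<in> center" "h l = (\<Sum>i<r. a i \<star> e i)"
    using basis_span by metis
  \<comment> \<open>The coordinates \<open>a i\<close> are central and may stand to the right of
    \<open>y\<close>, so both sides of \<open>key\<close> take the form needed for
    \<open>bimodule_independence\<close>.\<close>
  have "(\<Sum>i<r. e i \<star> y \<star> (a i - s i \<star> f)) = 0" for y
  proof -
    have "(\<Sum>i<r. e i \<star> y \<star> a i) = h l \<star> y"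
      unfolding a(2) mul_sum_left
      by (intro sum.cong) (auto simp: centerD[OF a(1)] mul_assoc)
    thus ?thesis using key[of y]
      by (simp add: s mul_diff_right sum_subtractf mul_sum_left mul_assoc)
  qed
  hence "a i = s i \<star> f" if "i < r" for i
    using bimodule_independence[of "\<lambda>i. a i - s i \<star> f" i] that by simp
  hence "\<forall>i\<in>{..<r}. \<exists>w. a i = w \<star> c" using ann a(1) by (metis lessThan_iff)
  then obtain w where w: "\<And>i. i < r \<Longrightarrow> a i = w i \<star> c" by (metis lessThan_iff)
  have "h l = (\<Sum>i<r. e i \<star> w i) \<star> c"
    unfolding a(2) mul_sum_left
    by (intro sum.cong refl) (metis a(1) centerD lessThan_iff mul_assoc w)
  with l lm show ?thesis by blast
qed

section \<open>Central relations between powers of f and the rank estimate\<close>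

text \<open>Division by a polynomial whose leading coefficient need not be a unit.
  \<open>red x\<close> says that a nonzero central multiple of \<open>x\<close> lies in the central
  span of the first \<open>N\<close> powers; it survives sums, central multiples, cancellation of
  central factors and, since the relation rewrites \<open>pw f N\<close>, multiplication by
  \<open>f\<close>.\<close>

lemma power_reduction:
  assumes c: "\<And>i. i \<le> N \<Longrightarrow> c i \<in> center" "c N \<noteq> 0" "(\<Sum>i\<le>N. c i \<star> pw f i) = 0"
  shows "\<exists>a\<in>center. a \<noteq> 0 \<and> (\<exists>g. (\<forall>i<N. g i \<in> center) \<and> a \<star> pw f k = (\<Sum>i<N. g i \<star> pw f i))"
proof -
  define red where "red x \<longleftrightarrow> (\<exists>a\<in>center. a \<noteq> 0 \<and>
    (\<exists>g. (\<forall>i<N. g i \<in> center) \<and> a \<star> x = (\<Sum>i<N. g i \<star> pw f i)))" for x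
  have redI: "red x" if "a \<in> center" "a \<noteq> 0" "\<And>i. i < N \<Longrightarrow> g i \<in> center"
    "a \<star> x = (\<Sum>i<N. g i \<star> pw f i)" for a x g
    using that unfolding red_def by blast
  have zero: "red 0"
    by (rule redI[of u "\<lambda>_. 0"]) (simp_all add: center_closed)
  have add: "red (x + y)" if "red x" "red y" for x y
  proof -
    obtain a g a' g' where *: "a \<in> center" "a \<noteq> 0" "\<And>i. i < N \<Longrightarrow> g i \<in> center"
      "a \<star> x = (\<Sum>i<N. g i \<star> pw f i)" "a' \<in> center" "a' \<noteq> 0" "\<And>i. i < N \<Longrightarrow> g' i \<in> center"
      "a' \<star> y = (\<Sum>i<N. g' i \<star> pw f i)"
      using \<open>red x\<close> \<open>red y\<close> unfolding red_def by blast
    have "a \<star> a' \<star> (x + y) = a' \<star> (a \<star> x) + a \<star> (a' \<star> y)"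
      using centerD[OF *(1), of a'] by (simp add: mul_add_right mul_assoc[symmetric])
    also have "\<dots> = (\<Sum>i<N. (a' \<star> g i + a \<star> g' i) \<star> pw f i)"
      by (simp add: *(4,8) mul_add_left sum.distrib mul_sum_right mul_assoc)
    finally show ?thesis
      by (intro redI[of "a \<star> a'" "\<lambda>i. a' \<star> g i + a \<star> g' i"]) (simp_all add: * center_closed)
  qed
  have mult: "red (d \<star> x)" if d: "d \<in> center" and "red x" for d x
  proof -
    obtain a g where *: "a \<in> center" "a \<noteq> 0" "\<And>i. i < N \<Longrightarrow> g i \<in> center"
      "a \<star> x = (\<Sum>i<N. g i \<star> pw f i)"
      using \<open>red x\<close> unfolding red_def by blast
    have "a \<star> (d \<star> x) = (\<Sum>i<N. (d \<star> g i) \<star> pw f i)"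
      using center_left_commute[OF d, of a x] by (simp add: * mul_sum_right mul_assoc)
    thus ?thesis
      by (intro redI[of a "\<lambda>i. d \<star> g i"]) (simp_all add: * d center_closed)
  qed
  have cancel: "red x" if d: "d \<in> center" "d \<noteq> 0" and "red (d \<star> x)" for d x
  proof -
    obtain a g where *: "a \<in> center" "a \<noteq> 0" "\<And>i. i < N \<Longrightarrow> g i \<in> center"
      "a \<star> (d \<star> x) = (\<Sum>i<N. g i \<star> pw f i)"
      using \<open>red (d \<star> x)\<close> unfolding red_def by blast
    thus ?thesis
      by (intro redI[of "a \<star> d" g]) (simp_all add: d center_closed mul_assoc)
  qed
  have sum: "red (\<Sum>i\<in>A. x i)" if "\<And>i. i \<in> A \<Longrightarrow> red (x i)" for A :: "nat set" and x
    using that by (induction A rule: infinite_finite_induct) (simp_all add: zero add)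
  have low: "red (pw f i)" if "i < N" for i
  proof (rule redI[of u "\<lambda>j. if j = i then u else 0"])
    have "(\<Sum>j<N. (if j = i then u else 0) \<star> pw f j) = (\<Sum>j<N. if j = i then pw f j else 0)"
      by (intro sum.cong) auto
    thus "u \<star> pw f i = (\<Sum>j<N. (if j = i then u else 0) \<star> pw f j)"
      using that by simp
  qed (auto simp: center_closed)
  have top: "red (pw f N)"
  proof (rule redI[of "c N" "\<lambda>i. - c i"])
    have "(\<Sum>i<N. c i \<star> pw f i) + c N \<star> pw f N = 0"
      using c(3) by (simp add: lessThan_Suc_atMost[symmetric])
    hence "- (\<Sum>i<N. c i \<star> pw f i) = c N \<star> pw f N" by (rule minus_unique)
    thus "c N \<star> pw f N = (\<Sum>i<N. (- c i) \<star> pw f i)"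
      by (simp add: mul_minus_left sum_negf)
  qed (use c in \<open>auto simp: center_closed\<close>)
  have step: "red (x \<star> f)" if "red x" for x
  proof -
    obtain a g where *: "a \<in> center" "a \<noteq> 0" "\<And>i. i < N \<Longrightarrow> g i \<in> center"
      "a \<star> x = (\<Sum>i<N. g i \<star> pw f i)"
      using \<open>red x\<close> unfolding red_def by blast
    have "red (\<Sum>i<N. g i \<star> pw f (Suc i))"
    proof (rule sum)
      fix i assume "i \<in> {..<N}"
      hence "i < N" by simp
      hence "red (pw f (Suc i))" using low[of "Suc i"] top by (cases "Suc i = N") auto
      thus "red (g i \<star> pw f (Suc i))" by (rule mult[OF *(3)[OF \<open>i < N\<close>]])
    qed
    also have "(\<Sum>i<N. g i \<star> pw f (Suc i)) = a \<star> (x \<star> f)"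
      using *(4) by (simp add: mul_sum_left flip: mul_assoc)
    finally show ?thesis by (rule cancel[OF *(1,2)])
  qed
  have "red (pw f k)"
  proof (induction k)
    case 0
    \<comment> \<open>For \<open>N = 0\<close> there are no lower powers and the initial power is
      itself the top one.\<close>
    show ?case using low[of 0] top by (cases "N = 0") auto
  qed (simp add: step)
  thus ?thesis by (simp add: red_def)
qed

text \<open>Denominators are cleared term by term. Up to a central denominator M is generated by the
  \<open>N\<close> maps \<open>y \<mapsto> y \<star> pw f i\<close>, so its rank is at most
  \<open>N\<close>.\<close>

lemma eval_maps_reduction:
  assumes c: "\<And>i. i \<le> N \<Longrightarrow> c i \<in> center" "c N \<noteq> 0" "(\<Sum>i\<le>N. c i \<star> pw f i) = 0"
    and "G \<in> eval_maps f"
  shows "\<exists>a g. a \<noteq> 0 \<and> a \<in> center \<and> (\<forall>y. a \<star> G y = (\<Sum>i<N. g i \<star> y \<star> pw f i))"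
  using assms(4)
proof (induction rule: eval_maps.induct)
  case (base h k)
  obtain a g where *: "a \<in> center" "a \<noteq> 0" "\<And>i. i < N \<Longrightarrow> g i \<in> center"
    "a \<star> pw f k = (\<Sum>i<N. g i \<star> pw f i)"
    using power_reduction[of N c f k] c by blast
  have "a \<star> (h \<star> y \<star> pw f k) = (\<Sum>i<N. (h \<star> g i) \<star> y \<star> pw f i)" for y
  proof -
    have "a \<star> (h \<star> y \<star> pw f k) = h \<star> y \<star> (a \<star> pw f k)"
      by (simp add: center_left_commute[OF *(1)])
    also have "\<dots> = (\<Sum>i<N. (h \<star> g i) \<star> y \<star> pw f i)"
      unfolding *(4) mul_sum_right
      by (intro sum.cong) (auto simp: mul_assoc center_left_commute[OF *(3)])
    finally show ?thesis .
  qed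
  with *(1,2) show ?case by (intro exI[of _ a] exI[of _ "\<lambda>i. h \<star> g i"]) simp
next
  case (add G H)
  obtain a g a' g' where *: "a \<in> center" "a \<noteq> 0" "\<And>y. a \<star> G y = (\<Sum>i<N. g i \<star> y \<star> pw f i)"
    "a' \<in> center" "a' \<noteq> 0" "\<And>y. a' \<star> H y = (\<Sum>i<N. g' i \<star> y \<star> pw f i)"
    using add.IH by blast
  have "a \<star> a' \<star> (G y + H y) = (\<Sum>i<N. (a' \<star> g i + a \<star> g' i) \<star> y \<star> pw f i)" for y
  proof -
    have "a \<star> a' \<star> (G y + H y) = a' \<star> (a \<star> G y) + a \<star> (a' \<star> H y)"
      using centerD[OF *(1), of a'] by (simp add: mul_add_right mul_assoc[symmetric])
    thus ?thesis
      by (simp add: *(3,6) mul_add_left sum.distrib mul_sum_right mul_assoc)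
  qed
  with * show ?case
    by (intro exI[of _ "a \<star> a'"] exI[of _ "\<lambda>i. a' \<star> g i + a \<star> g' i"]) (simp add: center_closed)
qed

text \<open>With \<open>N < card Y\<close> the top index of a nontrivial relation, the
  \<open>card Y\<close> dual maps would be expressed, up to denominators, through \<open>N\<close>
  generators. They would then satisfy a nontrivial left relation over R, which evaluation at the
  points of \<open>Y\<close> refutes.\<close>

lemma powers_independent:
  assumes "finite Y" "b \<noteq> 0"
    and G: "\<And>y. y \<in> Y \<Longrightarrow> G y \<in> eval_maps f"
      "\<And>y z. y \<in> Y \<Longrightarrow> z \<in> Y \<Longrightarrow> G y z = (if z = y then b else 0)"
    and c: "\<And>k. k < card Y \<Longrightarrow> c k \<in> center" "(\<Sum>k<card Y. c k \<star> pw f k) = 0"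
    and "k < card Y"
  shows "c k = 0"
proof (rule ccontr)
  assume "c k \<noteq> 0"
  define K where "K = {k. k < card Y \<and> c k \<noteq> 0}"
  define N where "N = Max K"
  have K: "finite K" "K \<noteq> {}" using \<open>c k \<noteq> 0\<close> \<open>k < card Y\<close> by (auto simp: K_def)
  have N: "N < card Y" "c N \<noteq> 0" using Max_in[OF K] by (auto simp: N_def K_def)
  have above: "c i = 0" if "i < card Y" "N < i" for i
  proof (rule ccontr)
    assume "c i \<noteq> 0"
    hence "i \<in> K" using that by (simp add: K_def)
    hence "i \<le> N" unfolding N_def by (rule Max_ge[OF K(1)])
    thus False using that by simp
  qed
  have "(\<Sum>i\<le>N. c i \<star> pw f i) = (\<Sum>i<card Y. c i \<star> pw f i)"
    using N(1) above by (intro sum.mono_neutral_left) auto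
  hence "(\<Sum>i\<le>N. c i \<star> pw f i) = 0" using c(2) by simp
  hence "\<forall>y\<in>Y. \<exists>a g. a \<noteq> 0 \<and> a \<in> center \<and> (\<forall>z. a \<star> G y z = (\<Sum>i<N. g i \<star> z \<star> pw f i))"
    using c(1) N by (intro ballI eval_maps_reduction[of N c] G) auto
  from bchoice[OF this] obtain a
    where "\<forall>y\<in>Y. \<exists>g. a y \<noteq> 0 \<and> a y \<in> center \<and> (\<forall>z. a y \<star> G y z = (\<Sum>i<N. g i \<star> z \<star> pw f i))"
    by blast
  from bchoice[OF this] obtain g where ag: "\<And>y. y \<in> Y \<Longrightarrow> a y \<noteq> 0"
    "\<And>y z. y \<in> Y \<Longrightarrow> a y \<star> G y z = (\<Sum>i<N. g y i \<star> z \<star> pw f i)"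
    by blast
  have "card {..<N} < card Y" "\<forall>y\<in>Y. \<forall>i\<in>{..<N}. g y i \<in> UNIV" using N by auto
  from more_unknowns_than_equations[OF ore_subring_UNIV finite_lessThan assms(1) this]
  obtain w where w: "\<exists>y\<in>Y. w y \<noteq> 0" "\<And>i. i < N \<Longrightarrow> (\<Sum>y\<in>Y. w y \<star> g y i) = 0"
    by blast
  have "w z = 0" if "z \<in> Y" for z
  proof -
    \<comment> \<open>By duality only the summand \<open>y = z\<close> survives at the point
      \<open>z\<close>.\<close>
    have "(\<Sum>y\<in>Y. w y \<star> (a y \<star> G y z)) = (\<Sum>i<N. \<Sum>y\<in>Y. w y \<star> g y i \<star> (z \<star> pw f i))"
      by (subst sum.swap) (simp add: ag(2) mul_sum_right mul_assoc)
    also have "\<dots> = 0" by (simp add: w(2) flip: mul_sum_left)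
    also have "(\<Sum>y\<in>Y. w y \<star> (a y \<star> G y z)) = (\<Sum>y\<in>Y. if y = z then w y \<star> (a y \<star> b) else 0)"
      using that by (intro sum.cong) (auto simp: G(2))
    also have "\<dots> = w z \<star> (a z \<star> b)" using that assms(1) by simp
    finally show ?thesis using ag(1)[OF that] assms(2) by simp
  qed
  with w(1) show False by blast
qed

text \<open>Applying \<open>G y\<close> to a central relation between the products
  \<open>z \<star> pw f k\<close> leaves \<open>b\<close> times a relation between powers of
  \<open>f\<close>, which is trivial. So \<open>card Y * card Y\<close> products are independent in
  a module of rank \<open>r\<close>.\<close>

lemma dual_points_square_le_rank:
  assumes "finite Y" "b \<in> center" "b \<noteq> 0"
    and G: "\<And>y. y \<in> Y \<Longrightarrow> G y \<in> eval_maps f"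
      "\<And>y z. y \<in> Y \<Longrightarrow> z \<in> Y \<Longrightarrow> G y z = (if z = y then b else 0)"
  shows "card Y * card Y \<le> r"
proof (rule ccontr)
  let ?I = "Y \<times> {..<card Y}"
  assume "\<not> ?thesis"
  hence "finite ?I" "r < card ?I" using assms(1) by (simp_all add: card_cartesian_product)
  from center_dependent[OF this, of "\<lambda>(y, k). y \<star> pw f k"] obtain c
    where c: "\<forall>i\<in>?I. c i \<in> center" "\<exists>i\<in>?I. c i \<noteq> 0" "(\<Sum>i\<in>?I. c i \<star> (case i of (y, k) \<Rightarrow> y \<star> pw f k)) = 0"
    by blast
  have "c (y, k) = 0" if y: "y \<in> Y" and k: "k < card Y" for y k
  proof -
    have "(\<Sum>z\<in>Y. \<Sum>k<card Y. c (z, k) \<star> (z \<star> pw f k)) = 0"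
      using c(3) by (simp add: sum.cartesian_product case_prod_unfold)
    hence "0 = G y (\<Sum>z\<in>Y. \<Sum>k<card Y. c (z, k) \<star> (z \<star> pw f k))"
      using eval_maps_linear(1)[OF G(1)[OF y], of 0 0] by simp
    also have "\<dots> = (\<Sum>z\<in>Y. \<Sum>k<card Y. c (z, k) \<star> (G y z \<star> pw f k))"
      unfolding eval_maps_sum_arg[OF G(1)[OF y]]
      using c(1) by (intro sum.cong) (auto simp: eval_maps_linear[OF G(1)[OF y]])
    also have "\<dots> = (\<Sum>z\<in>Y. if z = y then (\<Sum>k<card Y. c (z, k) \<star> (b \<star> pw f k)) else 0)"
      using y by (intro sum.cong) (auto simp: G(2))
    also have "\<dots> = (\<Sum>k<card Y. c (y, k) \<star> (b \<star> pw f k))"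
      using y assms(1) by simp
    also have "\<dots> = b \<star> (\<Sum>k<card Y. c (y, k) \<star> pw f k)"
      by (simp add: mul_sum_right center_left_commute[OF assms(2)])
    finally have "(\<Sum>k<card Y. c (y, k) \<star> pw f k) = 0" using assms(3) by simp
    thus ?thesis
      using powers_independent[OF assms(1,3) G, of "\<lambda>k. c (y, k)" k] c(1) y k by auto
  qed
  thus False using c(2) by auto
qed

section \<open>Choice of the evaluation points\<close>

lemma common_central_multiple:
  assumes "finite A" "\<And>i. i \<in> A \<Longrightarrow> \<beta> i \<in> center \<and> \<beta> i \<noteq> 0"
  shows "\<exists>b\<in>center. b \<noteq> 0 \<and> (\<forall>i\<in>A. \<exists>t. b = t \<star> \<beta> i)"
  using assms
proof (induction A rule: finite_induct)
  case empty
  show ?case by (intro bexI[of _ u]) (simp_all add: center_closed)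
next
  case (insert i A)
  then obtain b where b: "b \<in> center" "b \<noteq> 0" "\<forall>i\<in>A. \<exists>t. b = t \<star> \<beta> i" by blast
  have "\<exists>t. b \<star> \<beta> i = t \<star> \<beta> j" if "j \<in> insert i A" for j
  proof (cases "j = i")
    case False
    with that b(3) obtain t where "b = t \<star> \<beta> j" by blast
    hence "b \<star> \<beta> i = \<beta> i \<star> t \<star> \<beta> j" using centerD[OF b(1), of "\<beta> i"] by (simp add: mul_assoc)
    thus ?thesis by blast
  qed blast
  thus ?case using insert.prems[of i] b(1,2)
    by (intro bexI[of _ "b \<star> \<beta> i"]) (simp_all add: center_closed)
qed

text \<open>\<open>Y\<close> is a smallest finite set on which no nonzero map of M vanishes.
  Dropping \<open>y\<close> admits a nonzero map vanishing on the rest of \<open>Y\<close>, so its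
  value at \<open>y\<close> is nonzero; left factors turn all these values into one central
  \<open>b\<close>.\<close>

lemma evaluation_points:
  obtains Y b G where "finite Y" "card Y * card Y \<le> r" "b \<noteq> 0"
    "\<forall>H\<in>eval_maps f. (\<forall>y\<in>Y. H y = 0) \<longrightarrow> H = (\<lambda>_. 0)"
    "\<forall>y\<in>Y. G y \<in> eval_maps f"
    "\<forall>y\<in>Y. \<forall>z\<in>Y. G y z = (if z = y then b else 0)"
proof -
  define P where "P Y \<longleftrightarrow> finite Y \<and> (\<forall>H\<in>eval_maps f. (\<forall>y\<in>Y. H y = 0) \<longrightarrow> H = (\<lambda>_. 0))" for Y
  \<comment> \<open>A first candidate: maps in M are linear over the center, so they are determined
    by their values on the basis.\<close>
  have "P (e ` {..<r})"
  proof -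
    have "H x = 0" if H: "H \<in> eval_maps f" "\<forall>y\<in>e ` {..<r}. H y = 0" for H x
    proof -
      obtain c where c: "\<And>i. i < r \<Longrightarrow> c i \<in> center" "x = (\<Sum>i<r. c i \<star> e i)"
        using basis_span by blast
      show ?thesis
        unfolding c(2) eval_maps_sum_arg[OF H(1)]
        using H(2) by (intro sum.neutral) (auto simp: eval_maps_linear[OF H(1)] c(1))
    qed
    thus ?thesis by (auto simp: P_def fun_eq_iff)
  qed
  from ex_has_least_nat[of P, OF this, of card]
  obtain Y where Y: "P Y" "\<And>Z. P Z \<Longrightarrow> card Y \<le> card Z" by blast
  have fin: "finite Y" using Y(1) by (simp add: P_def)
  have "\<forall>y\<in>Y. \<exists>H. H \<in> eval_maps f \<and> (\<forall>z\<in>Y - {y}. H z = 0) \<and> H y \<in> center \<and> H y \<noteq> 0"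
  proof
    fix y assume y: "y \<in> Y"
    have "card (Y - {y}) < card Y" by (rule card_Diff1_less[OF fin y])
    hence "\<not> P (Y - {y})" using Y(2) by fastforce
    then obtain H where H: "H \<in> eval_maps f" "\<forall>z\<in>Y - {y}. H z = 0" "H \<noteq> (\<lambda>_. 0)"
      using fin by (auto simp: P_def)
    hence "H y \<noteq> 0" using Y(1) y unfolding P_def by (metis DiffI singletonD)
    then obtain v where "v \<star> H y \<in> center" "v \<star> H y \<noteq> 0" using central_multiple by blast
    with H show "\<exists>H. H \<in> eval_maps f \<and> (\<forall>z\<in>Y - {y}. H z = 0) \<and> H y \<in> center \<and> H y \<noteq> 0"
      by (intro exI[of _ "\<lambda>z. v \<star> H z"]) (simp add: eval_maps_left_mult)
  qed
  from bchoice[OF this] obtain H where H: "\<And>y. y \<in> Y \<Longrightarrow> H y \<in> eval_maps f"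
    "\<And>y z. y \<in> Y \<Longrightarrow> z \<in> Y - {y} \<Longrightarrow> H y z = 0" "\<And>y. y \<in> Y \<Longrightarrow> H y y \<in> center \<and> H y y \<noteq> 0"
    by blast
  from common_central_multiple[OF fin, of "\<lambda>y. H y y"] H(3)
  obtain b where b: "b \<in> center" "b \<noteq> 0" "\<forall>y\<in>Y. \<exists>t. b = t \<star> H y y" by blast
  from bchoice[OF b(3)] obtain t where t: "\<And>y. y \<in> Y \<Longrightarrow> b = t y \<star> H y y" by blast
  define G where "G y z = t y \<star> H y z" for y z
  have G: "G y \<in> eval_maps f" if "y \<in> Y" for y
    unfolding G_def by (rule eval_maps_left_mult[OF H(1)[OF that]])
  have Gb: "G y z = (if z = y then b else 0)" if "y \<in> Y" "z \<in> Y" for y z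
    unfolding G_def using that H(2)[of y z] t[of y] by auto
  show ?thesis
  proof (rule that[of Y b G])
    show "card Y * card Y \<le> r" by (rule dual_points_square_le_rank[OF fin b(1,2) G Gb])
    show "\<forall>H\<in>eval_maps f. (\<forall>y\<in>Y. H y = 0) \<longrightarrow> H = (\<lambda>_. 0)"
      using Y(1) by (simp add: P_def)
  qed (use fin b(2) G Gb in auto)
qed

end

section \<open>Degrees of Ore polynomials\<close>

lemma mult_domain_division_ring: "mult_domain ((*) :: 'a::division_ring \<Rightarrow> 'a \<Rightarrow> 'a) 1"
  by unfold_locales (simp_all add: algebra_simps)

text \<open>In a division ring \<open>p = 1\<close> and \<open>q = a * inverse b\<close> give the
  Ore condition, so the same elimination serves for counting D-dimensions.\<close>

lemma division_ring_more_unknowns: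
  fixes v :: "'i \<Rightarrow> 'j \<Rightarrow> 'a::division_ring"
  assumes "finite J" "finite I" "card J < card I"
  shows "\<exists>g. (\<exists>i\<in>I. g i \<noteq> 0) \<and> (\<forall>j\<in>J. (\<Sum>i\<in>I. g i * v i j) = 0)"
proof -
  interpret D: mult_domain "(*) :: 'a \<Rightarrow> 'a \<Rightarrow> 'a" 1 by (rule mult_domain_division_ring)
  have "\<exists>p q. p \<noteq> 0 \<and> p * a = q * b" if "b \<noteq> 0" for a b :: 'a
    using that by (intro exI[of _ 1] exI[of _ "a * inverse b"]) (simp add: mult.assoc)
  hence "D.ore_subring UNIV" by (simp add: D.ore_subring_def)
  from D.more_unknowns_than_equations[OF this assms, of v] show ?thesis by auto
qed

context
  fixes \<sigma> \<delta> :: "'a::division_ring \<Rightarrow> 'a"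
  assumes aut: "ring_automorphism \<sigma>" and der: "skew_derivation \<sigma> \<delta>"
begin

text \<open>In each multiplication by X the summand with \<open>\<sigma>\<close> raises the degree
  by one and twists the leading coefficient; the summand with \<open>\<delta>\<close> does not raise
  the degree.\<close>

lemma ore_X_pow_lead:
  "degree ((ore_X_mult \<sigma> \<delta> ^^ n) g) \<le> degree g + n"
  "coeff ((ore_X_mult \<sigma> \<delta> ^^ n) g) (degree g + n) = (\<sigma> ^^ n) (lead_coeff g)"
proof (induction n)
  case (Suc n)
  let ?h = "(ore_X_mult \<sigma> \<delta> ^^ n) g"
  have zero: "coeff ?h k = 0" if "k > degree g + n" for k
    using Suc.IH(1) that by (intro coeff_eq_0) simp
  { case 1
    show ?case
      by (rule degree_le)
         (auto simp: coeff_ore_X_mult[OF aut der] ore_map_zero[OF aut der] zero split: nat.splits)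
  next
    case 2
    show ?case
      using Suc.IH(2) by (simp add: coeff_ore_X_mult[OF aut der] ore_map_zero[OF aut der] zero)
  }
qed simp_all

lemma ore_automorphism_pow_nonzero: "a \<noteq> 0 \<Longrightarrow> (\<sigma> ^^ n) a \<noteq> 0"
proof (induction n)
  case (Suc n)
  have "inj \<sigma>" using aut by (simp add: ring_automorphism_def bij_is_inj)
  with Suc show ?case using ore_map_zero(1)[OF aut der] by (metis funpow.simps(2) injD o_apply)
qed simp

lemma degree_ore_mult_le: "degree (ore_mult \<sigma> \<delta> f g) \<le> degree f + degree g"
  unfolding ore_mult_def
proof (rule degree_sum_le)
  fix i assume "i \<in> {..degree f}"
  moreover have "degree (lscale (coeff f i) ((ore_X_mult \<sigma> \<delta> ^^ i) g)) \<le> degree g + i"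
    using ore_X_pow_lead(1)[of i g] by (intro degree_le) (auto simp: coeff_eq_0)
  ultimately show "degree (lscale (coeff f i) ((ore_X_mult \<sigma> \<delta> ^^ i) g)) \<le> degree f + degree g"
    by simp
qed simp

lemma coeff_ore_mult_lead:
  "coeff (ore_mult \<sigma> \<delta> f g) (degree f + degree g) = lead_coeff f * (\<sigma> ^^ degree f) (lead_coeff g)"
proof -
  have "coeff (ore_mult \<sigma> \<delta> f g) (degree f + degree g)
      = (\<Sum>i\<le>degree f. coeff f i * coeff ((ore_X_mult \<sigma> \<delta> ^^ i) g) (degree f + degree g))"
    by (simp add: ore_mult_def coeff_sum)
  also have "\<dots> = (\<Sum>i\<in>{degree f}. coeff f i * coeff ((ore_X_mult \<sigma> \<delta> ^^ i) g) (degree f + degree g))"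
  proof (rule sum.mono_neutral_right)
    show "\<forall>i\<in>{..degree f} - {degree f}.
        coeff f i * coeff ((ore_X_mult \<sigma> \<delta> ^^ i) g) (degree f + degree g) = 0"
    proof
      fix i assume "i \<in> {..degree f} - {degree f}"
      hence "i < degree f" by auto
      hence "degree ((ore_X_mult \<sigma> \<delta> ^^ i) g) < degree f + degree g"
        using ore_X_pow_lead(1)[of i g] by simp
      thus "coeff f i * coeff ((ore_X_mult \<sigma> \<delta> ^^ i) g) (degree f + degree g) = 0"
        by (simp add: coeff_eq_0)
    qed
  qed simp_all
  also have "\<dots> = lead_coeff f * (\<sigma> ^^ degree f) (lead_coeff g)"
    using ore_X_pow_lead(2)[of "degree f" g] by (simp add: add.commute)
  finally show ?thesis .
qed

lemma ore_mult_nonzero: "f \<noteq> 0 \<Longrightarrow> g \<noteq> 0 \<Longrightarrow> ore_mult \<sigma> \<delta> f g \<noteq> 0"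
  using coeff_ore_mult_lead[of f g] ore_automorphism_pow_nonzero[of "lead_coeff g" "degree f"]
  by auto

text \<open>Leading coefficients do not cancel, so degrees add. This excludes nonzero elements of R
  c of degree below that of \<open>c\<close>.\<close>

lemma degree_ore_mult_ge:
  assumes "ore_mult \<sigma> \<delta> f g \<noteq> 0"
  shows "degree g \<le> degree (ore_mult \<sigma> \<delta> f g)"
proof -
  interpret R: ring "ore_ring \<sigma> \<delta>" by (rule ring_ore_ring[OF aut der])
  have "f \<noteq> 0" "g \<noteq> 0"
    using assms R.l_null[of g] R.r_null[of f] by (auto simp: ore_ring_def)
  hence "coeff (ore_mult \<sigma> \<delta> f g) (degree f + degree g) \<noteq> 0"
    using coeff_ore_mult_lead[of f g] ore_automorphism_pow_nonzero[of "lead_coeff g" "degree f"]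
    by simp
  hence "degree f + degree g \<le> degree (ore_mult \<sigma> \<delta> f g)" by (rule le_degree)
  thus ?thesis by simp
qed

lemma mult_domain_ore: "mult_domain (ore_mult \<sigma> \<delta>) (monom 1 0)"
proof -
  interpret R: ring "ore_ring \<sigma> \<delta>" by (rule ring_ore_ring[OF aut der])
  show ?thesis
  proof
    fix a b c
    show "ore_mult \<sigma> \<delta> (ore_mult \<sigma> \<delta> a b) c = ore_mult \<sigma> \<delta> a (ore_mult \<sigma> \<delta> b c)"
      using R.m_assoc[of a b c] by (simp add: ore_ring_def)
    show "ore_mult \<sigma> \<delta> a (b + c) = ore_mult \<sigma> \<delta> a b + ore_mult \<sigma> \<delta> a c"
      using R.r_distr[of b c a] by (simp add: ore_ring_def)
    show "ore_mult \<sigma> \<delta> (monom 1 0) a = a" "ore_mult \<sigma> \<delta> a (monom 1 0) = a"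
      using R.l_one[of a] R.r_one[of a] by (simp_all add: ore_ring_def)
    show "ore_mult \<sigma> \<delta> a b = 0 \<Longrightarrow> a = 0 \<or> b = 0"
      using ore_mult_nonzero[of a b] by blast
  qed (simp_all add: ore_mult_add_left)
qed

lemma finsum_ore_ring: "finite A \<Longrightarrow> finsum (ore_ring \<sigma> \<delta>) g A = sum g A"
proof (induction A rule: finite_induct)
  case (insert x A)
  interpret R: ring "ore_ring \<sigma> \<delta>" by (rule ring_ore_ring[OF aut der])
  show ?case using R.finsum_insert[of A x g] insert by (simp add: ore_ring_def)
next
  case empty
  interpret R: ring "ore_ring \<sigma> \<delta>" by (rule ring_ore_ring[OF aut der])
  show ?case using R.finsum_empty by (simp add: ore_ring_def)
qed

lemma central_free_domain_ore:
  assumes "free_of_rank_over (ore_ring \<sigma> \<delta>) (ring_center (ore_ring \<sigma> \<delta>)) r"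
  shows "\<exists>e. central_free_domain (ore_mult \<sigma> \<delta>) (monom 1 0) r e"
proof -
  interpret mult_domain "ore_mult \<sigma> \<delta>" "monom 1 0" by (rule mult_domain_ore)
  have C: "ring_center (ore_ring \<sigma> \<delta>) = center"
    by (simp add: ring_center_def center_def ore_ring_def)
  obtain e where e: "\<And>x. \<exists>!c. c \<in> {..<r} \<rightarrow>\<^sub>E center \<and> x = (\<Sum>i<r. ore_mult \<sigma> \<delta> (c i) (e i))"
    using assms unfolding free_of_rank_over_def C
    by (auto simp: finsum_ore_ring) (auto simp: ore_ring_def)
  have "central_free_domain (ore_mult \<sigma> \<delta>) (monom 1 0) r e"
  proof
    fix x
    from e[of x] obtain c where "c \<in> {..<r} \<rightarrow>\<^sub>E center" "x = (\<Sum>i<r. ore_mult \<sigma> \<delta> (c i) (e i))"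
      by blast
    thus "\<exists>c. (\<forall>i<r. c i \<in> center) \<and> x = (\<Sum>i<r. ore_mult \<sigma> \<delta> (c i) (e i))"
      by (intro exI[of _ c]) (auto simp: PiE_iff)
  next
    fix c i assume c: "\<forall>i<r. c i \<in> center" "(\<Sum>i<r. ore_mult \<sigma> \<delta> (c i) (e i)) = 0" "i < r"
    let ?rep = "\<lambda>d. d \<in> {..<r} \<rightarrow>\<^sub>E center \<and> 0 = (\<Sum>i<r. ore_mult \<sigma> \<delta> (d i) (e i))"
    \<comment> \<open>Independence is uniqueness for the zero element; restriction makes both
      families extensional, so that they can be compared.\<close>
    have "?rep (restrict c {..<r})" "?rep (restrict (\<lambda>_. 0) {..<r})"
      using c(1,2) center_closed(2) by (auto simp: PiE_iff)
    with e[of 0] have "restrict c {..<r} = restrict (\<lambda>_. 0) {..<r}" by blast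
    thus "c i = 0" using c(3) by (metis lessThan_iff restrict_apply')
  qed
  thus ?thesis by blast
qed

section \<open>Dimension count over the skew field\<close>

lemma coeff_ore_mult_monom_sum:
  "coeff (ore_mult \<sigma> \<delta> (\<Sum>i<K. monom (a i) i) z) n
     = (\<Sum>i<K. a i * coeff ((ore_X_mult \<sigma> \<delta> ^^ i) z) n)"
  by (simp add: ore_mult_sum_left ore_mult_monom coeff_sum)

lemma degree_monom_sum_less:
  "K > 0 \<Longrightarrow> degree (\<Sum>i<K. monom (a i) i) < K"
  by (rule le_less_trans[OF degree_sum_le[of _ _ "K - 1"]])
     (auto intro: order.trans[OF degree_monom_le])

text \<open>
  Counting \<open>D\<close>-dimensions: the coefficients of \<open>h\<^sub>0, \<dots>, h\<^sub>m\<^sub>-\<^sub>1\<close> and of the quotients \<open>w\<^sub>y\<close> are the unknowns of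
  the homogeneous linear system \<open>\<Sum> h\<^sub>l y f\<^sup>l = w\<^sub>y \<beta>\<close>, \<open>y \<in> Y\<close>.
\<close>

lemma exists_low_degree_relation:
  fixes Y :: "'a poly set" and F :: "nat \<Rightarrow> 'a poly"
  assumes "finite Y" "\<beta> \<noteq> 0" "card Y * degree \<beta> < m * k"
  shows "\<exists>h w. (\<forall>l<m. degree (h l) < k) \<and> (\<exists>l<m. h l \<noteq> 0) \<and>
    (\<forall>y\<in>Y. (\<Sum>l<m. ore_mult \<sigma> \<delta> (h l) (ore_mult \<sigma> \<delta> y (F l))) = ore_mult \<sigma> \<delta> (w y) \<beta>)"
proof -
  interpret mult_domain "ore_mult \<sigma> \<delta>" "monom 1 0" by (rule mult_domain_ore)
  have k: "k > 0" using assms(3) by (cases k) auto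
  \<comment> \<open>\<open>B\<close> bounds the degrees of both sides of the relations sought.
    \<open>K\<close> is the largest size for \<open>w y\<close> that respects this bound, and the
    summand \<open>degree \<beta>\<close> keeps it positive.\<close>
  define B where "B = k + (\<Sum>y\<in>Y. degree y) + (\<Sum>l<m. degree (F l)) + degree \<beta>"
  define K where "K = Suc B - degree \<beta>"
  have K: "K > 0" "K + degree \<beta> = Suc B" by (simp_all add: K_def B_def)
  define I where "I = Sum_Type.Plus ({..<m} \<times> {..<k}) (Y \<times> {..<K})"
  \<comment> \<open>\<open>Inl\<close> indexes the coefficients of the \<open>h l\<close>, and
    \<open>Inr\<close> those of the \<open>w y\<close>, which move to the left side with a minus
    sign. The pair \<open>(y, n)\<close> stands for the equation of coefficient \<open>n\<close> at
    the point \<open>y\<close>.\<close>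
  define v where "v i j = (case i of
      Inl (l, i) \<Rightarrow> coeff ((ore_X_mult \<sigma> \<delta> ^^ i) (ore_mult \<sigma> \<delta> (fst j) (F l))) (snd j)
    | Inr (y, i) \<Rightarrow> if fst j = y then - coeff ((ore_X_mult \<sigma> \<delta> ^^ i) \<beta>) (snd j) else 0)"
    for i :: "nat \<times> nat + 'a poly \<times> nat" and j :: "'a poly \<times> nat"
  have "card (Y \<times> {..B}) = card Y * (K + degree \<beta>)"
    by (simp add: card_cartesian_product K)
  also have "\<dots> < m * k + card Y * K" using assms(3) by (simp add: algebra_simps)
  also have "\<dots> = card I" using assms(1) by (simp add: I_def card_Plus card_cartesian_product)
  finally have card: "card (Y \<times> {..B}) < card I" .
  have finI: "finite I" using assms(1) by (simp add: I_def)
  obtain g where g: "\<exists>i\<in>I. g i \<noteq> 0" "\<And>y n. y \<in> Y \<Longrightarrow> n \<le> B \<Longrightarrow> (\<Sum>i\<in>I. g i * v i (y, n)) = 0"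
    using division_ring_more_unknowns[OF _ finI card, of v] assms(1) by auto
  define h where "h l = (\<Sum>i<k. monom (g (Inl (l, i))) i)" for l
  define w where "w y = (\<Sum>i<K. monom (g (Inr (y, i))) i)" for y
  have degh: "degree (h l) < k" for l unfolding h_def by (rule degree_monom_sum_less[OF k])
  have degw: "degree (w y) < K" for y unfolding w_def by (rule degree_monom_sum_less[OF K(1)])
  have eq: "(\<Sum>l<m. ore_mult \<sigma> \<delta> (h l) (ore_mult \<sigma> \<delta> y (F l))) = ore_mult \<sigma> \<delta> (w y) \<beta>"
    if y: "y \<in> Y" for y
  proof (rule poly_eqI)
    fix n
    show "coeff (\<Sum>l<m. ore_mult \<sigma> \<delta> (h l) (ore_mult \<sigma> \<delta> y (F l))) n = coeff (ore_mult \<sigma> \<delta> (w y) \<beta>) n"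
    proof (cases "n \<le> B")
      case True
      have "(\<Sum>i\<in>I. g i * v i (y, n)) =
          (\<Sum>(l, i)\<in>{..<m} \<times> {..<k}. g (Inl (l, i)) * v (Inl (l, i)) (y, n))
          + (\<Sum>(z, i)\<in>Y \<times> {..<K}. g (Inr (z, i)) * v (Inr (z, i)) (y, n))"
        unfolding I_def using assms(1) by (simp add: sum.Plus case_prod_unfold)
      also have "(\<Sum>(l, i)\<in>{..<m} \<times> {..<k}. g (Inl (l, i)) * v (Inl (l, i)) (y, n))
          = coeff (\<Sum>l<m. ore_mult \<sigma> \<delta> (h l) (ore_mult \<sigma> \<delta> y (F l))) n"
        by (simp add: v_def coeff_sum h_def coeff_ore_mult_monom_sum flip: sum.cartesian_product)
      also have "(\<Sum>(z, i)\<in>Y \<times> {..<K}. g (Inr (z, i)) * v (Inr (z, i)) (y, n))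
          = (\<Sum>z\<in>Y. if z = y then - coeff (ore_mult \<sigma> \<delta> (w y) \<beta>) n else 0)"
        unfolding sum.cartesian_product[symmetric]
        by (intro sum.cong) (auto simp: v_def w_def coeff_ore_mult_monom_sum sum_negf)
      also have "\<dots> = - coeff (ore_mult \<sigma> \<delta> (w y) \<beta>) n" using y assms(1) by simp
      finally show ?thesis using g(2)[OF y True] by simp
    next
      case False
      have "degree (ore_mult \<sigma> \<delta> (h l) (ore_mult \<sigma> \<delta> y (F l))) \<le> B" if l: "l \<in> {..<m}" for l
      proof -
        have "degree (ore_mult \<sigma> \<delta> (h l) (ore_mult \<sigma> \<delta> y (F l))) \<le> degree (h l) + (degree y + degree (F l))"
          by (meson add_left_mono degree_ore_mult_le order.trans)
        moreover have "degree y \<le> (\<Sum>y\<in>Y. degree y)" using y assms(1) by (intro member_le_sum) auto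
        moreover have "degree (F l) \<le> (\<Sum>l<m. degree (F l))" using l by (intro member_le_sum) auto
        ultimately show ?thesis using degh[of l] by (simp add: B_def)
      qed
      hence "degree (\<Sum>l<m. ore_mult \<sigma> \<delta> (h l) (ore_mult \<sigma> \<delta> y (F l))) \<le> B"
        by (intro degree_sum_le) auto
      moreover have "degree (ore_mult \<sigma> \<delta> (w y) \<beta>) \<le> B"
        using degree_ore_mult_le[of "w y" \<beta>] degw[of y] K(2) by simp
      ultimately show ?thesis using False by (simp add: coeff_eq_0)
    qed
  qed
  have coeff_h: "coeff (h l) i = g (Inl (l, i))" if "i < k" for l i
    using that by (simp add: h_def coeff_sum)
  have coeff_w: "coeff (w y) i = g (Inr (y, i))" if "i < K" for y i
    using that by (simp add: w_def coeff_sum)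
  \<comment> \<open>If all \<open>h l\<close> vanished, so would every \<open>w y\<close>, as
    \<open>\<beta>\<close> is nonzero, and with them all unknowns.\<close>
  have "\<exists>l<m. h l \<noteq> 0"
  proof (rule ccontr)
    assume h: "\<not> ?thesis"
    have w: "w y = 0" if "y \<in> Y" for y
      using eq[OF that] h assms(2) by simp
    have "g i = 0" if "i \<in> I" for i
    proof (cases i)
      case (Inl p)
      with that obtain l j where "p = (l, j)" "l < m" "j < k" by (auto simp: I_def)
      with Inl h coeff_h[of j l] show ?thesis by auto
    next
      case (Inr p)
      with that obtain y j where "p = (y, j)" "y \<in> Y" "j < K" by (auto simp: I_def)
      with Inr w coeff_w[of j y] show ?thesis by auto
    qed
    with g(1) show False by blast
  qed
  with degh eq show ?thesis by blast
qed

text \<open>Take \<open>d = card Y\<close>. Were the degree of \<open>c\<close> larger than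
  \<open>d * degree f\<close>, the count would give, for a large \<open>m\<close>, a relation modulo
  \<open>pw f m\<close> with all \<open>h l\<close> of degree below that of \<open>c\<close>, while
  \<open>coeffs_mod_power\<close> puts a nonzero \<open>h l\<close> into R c.\<close>

lemma degree_central_bound:
  assumes free: "free_of_rank_over (ore_ring \<sigma> \<delta>) (ring_center (ore_ring \<sigma> \<delta>)) r"
    and "f \<noteq> 0"
    and ann: "\<And>x a. x \<in> ring_center (ore_ring \<sigma> \<delta>) \<Longrightarrow> x = ore_mult \<sigma> \<delta> a f \<Longrightarrow> \<exists>w. x = ore_mult \<sigma> \<delta> w c"
  shows "\<exists>d. d * d \<le> r \<and> degree c \<le> d * degree f"
proof -
  obtain e where "central_free_domain (ore_mult \<sigma> \<delta>) (monom 1 0) r e"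
    using central_free_domain_ore[OF free] by blast
  then interpret central_free_domain "ore_mult \<sigma> \<delta>" "monom 1 0" r e .
  have C: "ring_center (ore_ring \<sigma> \<delta>) = center"
    by (simp add: ring_center_def center_def ore_ring_def)
  obtain Y b G where Y: "finite Y" "card Y * card Y \<le> r" "b \<noteq> 0"
    "\<forall>H\<in>eval_maps f. (\<forall>y\<in>Y. H y = 0) \<longrightarrow> H = (\<lambda>_. 0)"
    "\<forall>y\<in>Y. G y \<in> eval_maps f"
    "\<forall>y\<in>Y. \<forall>z\<in>Y. G y z = (if z = y then b else 0)"
    using evaluation_points[of f] by blast
  have "degree c \<le> card Y * degree f"
  proof (rule ccontr)
    assume "\<not> ?thesis"
    hence less: "Suc (card Y * degree f) \<le> degree c" by simp
    \<comment> \<open>Each unit of \<open>m\<close> gains at least one dimension over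
      \<open>card Y * degree f\<close>, so \<open>m\<close> has to exceed the fixed cost
      \<open>card Y * degree b\<close> of the denominator \<open>b\<close>.\<close>
    define m where "m = Suc (card Y * degree b)"
    have degpow: "degree (pw f n) \<le> n * degree f" for n
    proof (induction n)
      case (Suc n)
      thus ?case using degree_ore_mult_le[of "pw f n" f] by simp
    qed (simp add: degree_monom_eq)
    let ?\<beta> = "ore_mult \<sigma> \<delta> b (pw f m)"
    have "degree ?\<beta> \<le> degree b + m * degree f"
      using degree_ore_mult_le[of b "pw f m"] degpow[of m] by simp
    hence "card Y * degree ?\<beta> \<le> card Y * (degree b + m * degree f)" by (rule mult_le_mono2)
    also have "\<dots> < m * Suc (card Y * degree f)" by (simp add: m_def algebra_simps)
    also have "\<dots> \<le> m * degree c" using less by (rule mult_le_mono2)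
    finally have "card Y * degree ?\<beta> < m * degree c" .
    moreover have "?\<beta> \<noteq> 0" using Y(3) pw_nonzero[OF assms(2)] by simp
    ultimately obtain h w where h: "\<forall>l<m. degree (h l) < degree c" "\<exists>l<m. h l \<noteq> 0"
      "\<And>y. y \<in> Y \<Longrightarrow> (\<Sum>l<m. ore_mult \<sigma> \<delta> (h l) (ore_mult \<sigma> \<delta> y (pw f l))) = ore_mult \<sigma> \<delta> (w y) ?\<beta>"
      using exists_low_degree_relation[OF Y(1), of ?\<beta> m "degree c" "pw f"] by blast
    \<comment> \<open>\<open>H\<close> interpolates: at \<open>y\<close> in \<open>Y\<close> it
      takes the value \<open>w y\<close> times \<open>b\<close>, so the right side of the relation
      becomes \<open>H y\<close> times \<open>pw f m\<close>.\<close>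
    define H where "H z = (\<Sum>y\<in>Y. ore_mult \<sigma> \<delta> (w y) (G y z))" for z
    have H: "H \<in> eval_maps f"
      unfolding H_def by (intro eval_maps_sum eval_maps_left_mult Y(5)[rule_format])
    have HY: "H y = ore_mult \<sigma> \<delta> (w y) b" if "y \<in> Y" for y
    proof -
      have "H y = (\<Sum>z\<in>Y. if z = y then ore_mult \<sigma> \<delta> (w y) b else 0)"
        unfolding H_def using that by (intro sum.cong) (auto simp: Y(6))
      thus ?thesis using that Y(1) by simp
    qed
    \<comment> \<open>The difference lies in M and vanishes on \<open>Y\<close>, so the relation
      extends from \<open>Y\<close> to all of R.\<close>
    have "(\<lambda>z. (\<Sum>l<m. ore_mult \<sigma> \<delta> (ore_mult \<sigma> \<delta> (h l) z) (pw f l)) - ore_mult \<sigma> \<delta> (H z) (pw f m)) = (\<lambda>_. 0)"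
    proof (rule Y(4)[rule_format])
      show "(\<lambda>z. (\<Sum>l<m. ore_mult \<sigma> \<delta> (ore_mult \<sigma> \<delta> (h l) z) (pw f l)) - ore_mult \<sigma> \<delta> (H z) (pw f m))
          \<in> eval_maps f"
        by (intro eval_maps_diff eval_maps_sum eval_maps.base eval_maps_right_mult H)
    qed (simp add: h(3) HY mul_assoc)
    hence eq: "(\<Sum>l<m. ore_mult \<sigma> \<delta> (ore_mult \<sigma> \<delta> (h l) z) (pw f l)) = ore_mult \<sigma> \<delta> (H z) (pw f m)" for z
      by (metis (no_types, lifting) eq_iff_diff_eq_0)
    obtain l where l: "l < m" "h l \<noteq> 0" using h(2) by blast
    have "\<exists>l<m. h l \<noteq> 0 \<and> (\<exists>w. h l = ore_mult \<sigma> \<delta> w c)"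
      by (rule coeffs_mod_power[OF assms(2) _ H eq l]) (use ann C in blast)
    then obtain l a where "l < m" "h l \<noteq> 0" "h l = ore_mult \<sigma> \<delta> a c" by blast
    thus False using degree_ore_mult_ge[of a c] h(1) by fastforce
  qed
  with Y(2) show ?thesis by blast
qed

end

section \<open>Central ideals and the degree of the bound\<close>

text \<open>A central generator moves past factors on its right, so its left ideal is twosided. The
  maximality of the bound can thus be applied to central elements of R f.\<close>

lemma central_principal_ideal:
  assumes "ring R" "x \<in> ring_center R"
  shows "ideal (carrier R #>\<^bsub>R\<^esub> x) R"
proof -
  interpret ring R by (rule assms(1))
  have x: "x \<in> carrier R" "\<And>y. y \<in> carrier R \<Longrightarrow> x \<otimes>\<^bsub>R\<^esub> y = y \<otimes>\<^bsub>R\<^esub> x"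
    using assms(2) by (auto simp: ring_center_def)
  have mem: "z \<in> carrier R #>\<^bsub>R\<^esub> x \<longleftrightarrow> (\<exists>a\<in>carrier R. z = a \<otimes>\<^bsub>R\<^esub> x)" for z
    by (auto simp: r_coset_def)
  show ?thesis
  proof (rule idealI[OF assms(1)])
    show "subgroup (carrier R #>\<^bsub>R\<^esub> x) (add_monoid R)"
    proof (rule group.subgroupI[OF a_group])
      show "carrier R #>\<^bsub>R\<^esub> x \<subseteq> carrier (add_monoid R)" using x(1) by (auto simp: mem)
      show "carrier R #>\<^bsub>R\<^esub> x \<noteq> {}" using mem zero_closed by blast
    next
      fix a assume "a \<in> carrier R #>\<^bsub>R\<^esub> x"
      then obtain y where y: "y \<in> carrier R" "a = y \<otimes>\<^bsub>R\<^esub> x" unfolding mem by blast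
      have "\<ominus>\<^bsub>R\<^esub> a = (\<ominus>\<^bsub>R\<^esub> y) \<otimes>\<^bsub>R\<^esub> x" using y x(1) by (simp add: l_minus)
      hence "\<ominus>\<^bsub>R\<^esub> a \<in> carrier R #>\<^bsub>R\<^esub> x" using y(1) unfolding mem by blast
      thus "inv\<^bsub>add_monoid R\<^esub> a \<in> carrier R #>\<^bsub>R\<^esub> x" by (simp add: a_inv_def)
    next
      fix a b assume "a \<in> carrier R #>\<^bsub>R\<^esub> x" "b \<in> carrier R #>\<^bsub>R\<^esub> x"
      then obtain y z where yz: "y \<in> carrier R" "a = y \<otimes>\<^bsub>R\<^esub> x" "z \<in> carrier R" "b = z \<otimes>\<^bsub>R\<^esub> x"
        unfolding mem by blast
      have "a \<oplus>\<^bsub>R\<^esub> b = (y \<oplus>\<^bsub>R\<^esub> z) \<otimes>\<^bsub>R\<^esub> x" using yz x(1) by (simp add: l_distr)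
      hence "a \<oplus>\<^bsub>R\<^esub> b \<in> carrier R #>\<^bsub>R\<^esub> x" using yz unfolding mem by blast
      thus "a \<otimes>\<^bsub>add_monoid R\<^esub> b \<in> carrier R #>\<^bsub>R\<^esub> x" by simp
    qed
  next
    fix a b assume ab: "a \<in> carrier R #>\<^bsub>R\<^esub> x" "b \<in> carrier R"
    then obtain y where y: "y \<in> carrier R" "a = y \<otimes>\<^bsub>R\<^esub> x" unfolding mem by blast
    have "b \<otimes>\<^bsub>R\<^esub> a = (b \<otimes>\<^bsub>R\<^esub> y) \<otimes>\<^bsub>R\<^esub> x" using y ab(2) x(1) by (simp add: m_assoc)
    thus "b \<otimes>\<^bsub>R\<^esub> a \<in> carrier R #>\<^bsub>R\<^esub> x" using y(1) ab(2) unfolding mem by blast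
    have "a \<otimes>\<^bsub>R\<^esub> b = (y \<otimes>\<^bsub>R\<^esub> b) \<otimes>\<^bsub>R\<^esub> x" using y ab(2) x by (simp add: m_assoc)
    thus "a \<otimes>\<^bsub>R\<^esub> b \<in> carrier R #>\<^bsub>R\<^esub> x" using y(1) ab(2) unfolding mem by blast
  qed
qed

theorem theorem2p9:
  fixes \<sigma> \<delta> :: "'a::division_ring \<Rightarrow> 'a"
    and r :: nat
    and f fstar :: "'a poly"
  assumes "ring_automorphism \<sigma>"
    and "skew_derivation \<sigma> \<delta>"
    and "free_of_rank_over (ore_ring \<sigma> \<delta>) (ring_center (ore_ring \<sigma> \<delta>)) r"
    and "is_bound (ore_ring \<sigma> \<delta>) f fstar"
    and "fstar \<in> ring_center (ore_ring \<sigma> \<delta>)"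
  shows "ore_deg fstar \<le> ereal (sqrt (real r)) * ore_deg f"
proof -
  let ?R = "ore_ring \<sigma> \<delta>"
  interpret R: ring ?R by (rule ring_ore_ring[OF assms(1,2)])
  have mem: "z \<in> carrier ?R #>\<^bsub>?R\<^esub> x \<longleftrightarrow> (\<exists>a. z = ore_mult \<sigma> \<delta> a x)" for z x
    by (auto simp: r_coset_def ore_ring_def)
  have one: "x = ore_mult \<sigma> \<delta> (monom 1 0) x" for x
    using R.l_one[of x] by (simp add: ore_ring_def)
  have bound: "carrier ?R #>\<^bsub>?R\<^esub> fstar \<subseteq> carrier ?R #>\<^bsub>?R\<^esub> f"
    "\<And>I. ideal I ?R \<Longrightarrow> I \<subseteq> carrier ?R #>\<^bsub>?R\<^esub> f \<Longrightarrow> I \<subseteq> carrier ?R #>\<^bsub>?R\<^esub> fstar"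
    using assms(4) by (auto simp: is_bound_def)
  consider "fstar = 0" | "f = 0" "fstar \<noteq> 0" | "f \<noteq> 0" "fstar \<noteq> 0" by blast
  thus ?thesis
  proof cases
    case 1
    thus ?thesis by (simp add: ore_deg_def)
  next
    case 2
    \<comment> \<open>For \<open>f = 0\<close> the left ideal R f is zero and cannot contain a
      nonzero bound.\<close>
    have "fstar \<in> carrier ?R #>\<^bsub>?R\<^esub> f" using bound(1) one[of fstar] mem by blast
    then obtain a where "fstar = ore_mult \<sigma> \<delta> a 0" using mem 2(1) by blast
    hence "fstar = 0" using R.r_null[of a] by (simp add: ore_ring_def)
    with 2 show ?thesis by simp
  next
    case 3
    \<comment> \<open>This is the hypothesis \<open>ann\<close> for \<open>fstar\<close>: a central
      \<open>x\<close> in R f generates a twosided ideal inside R f, which lies in the largest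
      one.\<close>
    have "\<exists>w. x = ore_mult \<sigma> \<delta> w fstar"
      if x: "x \<in> ring_center ?R" "x = ore_mult \<sigma> \<delta> a f" for x a
    proof -
      have "carrier ?R #>\<^bsub>?R\<^esub> x \<subseteq> carrier ?R #>\<^bsub>?R\<^esub> f"
      proof
        fix z assume "z \<in> carrier ?R #>\<^bsub>?R\<^esub> x"
        then obtain b where "z = ore_mult \<sigma> \<delta> b (ore_mult \<sigma> \<delta> a f)" using mem x(2) by blast
        also have "\<dots> = ore_mult \<sigma> \<delta> (ore_mult \<sigma> \<delta> b a) f"
          using R.m_assoc[of b a f] by (simp add: ore_ring_def)
        finally show "z \<in> carrier ?R #>\<^bsub>?R\<^esub> f" using mem by blast
      qed
      hence "carrier ?R #>\<^bsub>?R\<^esub> x \<subseteq> carrier ?R #>\<^bsub>?R\<^esub> fstar"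
        by (intro bound(2) central_principal_ideal R.ring_axioms x(1))
      thus ?thesis using one[of x] mem by blast
    qed
    then obtain d where d: "d * d \<le> r" "degree fstar \<le> d * degree f"
      using degree_central_bound[OF assms(1,2,3) 3(1), of fstar] by blast
    have "real d * real d \<le> real r" using d(1) by (metis of_nat_le_iff of_nat_mult)
    hence "real d \<le> sqrt (real r)" by (intro real_le_rsqrt) (simp add: power2_eq_square)
    moreover have "real (degree fstar) \<le> real d * real (degree f)"
      using d(2) by (metis of_nat_le_iff of_nat_mult)
    ultimately have "real (degree fstar) \<le> sqrt (real r) * real (degree f)"
      by (meson mult_right_mono of_nat_0_le_iff order.trans)
    with 3 show ?thesis by (simp add: ore_deg_def)
  qed
qed

end
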